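(* Let $H$ be a finite simple graph (with nonempty vertex set), and let $G$ be a graph obtained from $H$ by adding to each vertex of $H$ at least one pendant. Then all the symbolic powers $J(G)^{(n)}$, $n\ge 1$, of the cover ideal $J(G)$ of $G$ are Koszul.
   Context: Adding a pendant to a vertex $v$ means adding a new vertex of degree $1$ adjacent only to $v$. Let $k$ be a field and $R=k[x_v : v\in V(G)]$ with the standard grading. The cover ideal of $G$ is $J(G)=\bigcap_{\{u,v\}\in E(G)}(x_u,x_v)\subseteq R$. The $n$-th symbolic power of an ideal $I$ is $I^{(n)}=\bigcap_{\mathfrak p\in\operatorname{Min}(I)}(I^nR_{\mathfrak p}\cap R)$, where $\operatorname{Min}(I)$ is the set of minimal primes of $I$; for cover ideals this gives $J(G)^{(n)}=\bigcap_{\{u,v\}\in E(G)}(x_u,x_v)^n$. Let $\mathfrak m$ be the graded maximal ideal of $R$. For a finitely generated graded $R$-module $M$ with minimal graded free resolution $F$, let $\mathcal F^iF$ be the subcomplex $\cdots\to F_{i+1}\to F_i\to \mathfrak mF_{i-1}\to\cdots\to\mathfrak m^iF_0\to 0$, let $\operatorname{lin}^RF=\bigoplus_{i\ge0}\mathcal F^iF/\mathcal F^{i+1}F$, and let $\operatorname{ld}_RM=\sup\{i : H_i(\operatorname{lin}^RF)\ne0\}$. $M$ is called Koszul if $\operatorname{ld}_RM=0$. Since $R$ is a polynomial ring, this is equivalent to $M$ being componentwise linear: for every $d$, the submodule generated by the homogeneous elements of degree $d$ of $M$ has a $d$-linear resolution. *)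

theory Defs
  imports
    "HOL-Library.Poly_Mapping"
    "HOL-Library.Extended_Nat"
    "Jordan_Normal_Form.Matrix"
begin

text \<open>Ideals of a commutative ring are its submodules as a module over itself, taken from
  \<^theory>\<open>HOL.Modules\<close>.\<close>

abbreviation is_ideal :: "'r::comm_ring_1 set \<Rightarrow> bool" where
  "is_ideal \<equiv> Modules.module.subspace (*)"

abbreviation ideal_span :: "'r::comm_ring_1 set \<Rightarrow> 'r set" where
  "ideal_span \<equiv> Modules.module.span (*)"

definition ideal_power :: "'r::comm_ring_1 set \<Rightarrow> nat \<Rightarrow> 'r set" where
  "ideal_power I n = ideal_span {\<Prod>i<n. f i | f. \<forall>i<n. f i \<in> I}"

definition prime_ideal :: "'r::comm_ring_1 set \<Rightarrow> bool" where
  "prime_ideal P \<longleftrightarrow> is_ideal P \<and> P \<noteq> UNIV \<and> (\<forall>a b. a * b \<in> P \<longrightarrow> a \<in> P \<or> b \<in> P)"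

definition minimal_primes :: "'r::comm_ring_1 set \<Rightarrow> 'r set set" where
  "minimal_primes I =
     {P. prime_ideal P \<and> I \<subseteq> P \<and> (\<forall>Q. prime_ideal Q \<and> I \<subseteq> Q \<and> Q \<subseteq> P \<longrightarrow> Q = P)}"

text \<open>Equality of the fractions \<open>a/s\<close> and \<open>b/t\<close> (with \<open>s\<close>, \<open>t\<close> outside \<open>P\<close>) in the
  localization at the prime ideal \<open>P\<close>.\<close>

definition frac_eq_at :: "'r::comm_ring_1 set \<Rightarrow> 'r \<Rightarrow> 'r \<Rightarrow> 'r \<Rightarrow> 'r \<Rightarrow> bool" where
  "frac_eq_at P a s b t \<longleftrightarrow> (\<exists>u. u \<notin> P \<and> u * (a * t - b * s) = 0)"

text \<open>\<open>I R\<^sub>P \<inter> R\<close>: the extension of \<open>I\<close> to the localization at \<open>P\<close> consists of the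
  fractions \<open>a/s\<close> with \<open>a \<in> I\<close> and \<open>s \<notin> P\<close>, and intersecting with \<open>R\<close> means taking the
  preimage under \<open>f \<mapsto> f/1\<close>.\<close>

definition local_contraction :: "'r::comm_ring_1 set \<Rightarrow> 'r set \<Rightarrow> 'r set" where
  "local_contraction P I = {f. \<exists>a s. a \<in> I \<and> s \<notin> P \<and> frac_eq_at P f 1 a s}"

definition symbolic_power :: "'r::comm_ring_1 set \<Rightarrow> nat \<Rightarrow> 'r set" where
  "symbolic_power I n = (\<Inter>P\<in>minimal_primes I. local_contraction P (ideal_power I n))"

text \<open>The polynomial ring with variables indexed by a finite type \<open>'v\<close>: monomials are exponent
  vectors, polynomials are finitely supported coefficient functions on monomials.\<close>

type_synonym ('v, 'k) mpoly = "('v \<Rightarrow>\<^sub>0 nat) \<Rightarrow>\<^sub>0 'k"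

definition var :: "'v \<Rightarrow> ('v, 'k::field) mpoly" where
  "var v = Poly_Mapping.single (Poly_Mapping.single v 1) 1"

definition mdeg :: "('v::finite \<Rightarrow>\<^sub>0 nat) \<Rightarrow> nat" where
  "mdeg m = (\<Sum>v\<in>UNIV. Poly_Mapping.lookup m v)"

definition homogeneous :: "int \<Rightarrow> ('v::finite, 'k::field) mpoly \<Rightarrow> bool" where
  "homogeneous d p \<longleftrightarrow> (\<forall>m\<in>Poly_Mapping.keys p. int (mdeg m) = d)"

definition max_ideal :: "('v, 'k::field) mpoly set" where
  "max_ideal = ideal_span (range var)"

text \<open>A complex of graded free modules of finite rank: in homological degree \<open>i\<close> the module is
  free of rank \<open>rk i\<close>, its \<open>j\<close>-th basis element has degree \<open>shift i j\<close>, and \<open>diff i\<close> is the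
  matrix of the differential from degree \<open>i + 1\<close> to degree \<open>i\<close>.\<close>

record 'r free_complex =
  rk :: "nat \<Rightarrow> nat"
  shift :: "nat \<Rightarrow> nat \<Rightarrow> int"
  diff :: "nat \<Rightarrow> 'r mat"

definition graded_free_complex :: "('v::finite, 'k::field) mpoly free_complex \<Rightarrow> bool" where
  "graded_free_complex F \<longleftrightarrow>
     (\<forall>i. diff F i \<in> carrier_mat (rk F i) (rk F (Suc i))) \<and>
     (\<forall>i. \<forall>a<rk F i. \<forall>b<rk F (Suc i).
        homogeneous (shift F (Suc i) b - shift F i a) (diff F i $$ (a, b))) \<and>
     (\<forall>i. diff F i * diff F (Suc i) = 0\<^sub>m (rk F i) (rk F (Suc (Suc i))))"

text \<open>\<open>g\<close> is the augmentation onto the ideal \<open>I\<close>, given by the images of the basis elements in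
  homological degree 0; it has degree 0.\<close>

definition graded_free_resolution ::
    "('v::finite, 'k::field) mpoly free_complex \<Rightarrow> ('v, 'k) mpoly vec \<Rightarrow> ('v, 'k) mpoly set \<Rightarrow> bool" where
  "graded_free_resolution F g I \<longleftrightarrow>
     graded_free_complex F \<and>
     g \<in> carrier_vec (rk F 0) \<and>
     (\<forall>j<rk F 0. homogeneous (shift F 0 j) (g $ j)) \<and>
     (\<lambda>x. g \<bullet> x) ` carrier_vec (rk F 0) = I \<and>
     {x \<in> carrier_vec (rk F 0). g \<bullet> x = 0} =
       (\<lambda>y. diff F 0 *\<^sub>v y) ` carrier_vec (rk F 1) \<and>
     (\<forall>i. {x \<in> carrier_vec (rk F (Suc i)). diff F i *\<^sub>v x = 0\<^sub>v (rk F i)} =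
       (\<lambda>y. diff F (Suc i) *\<^sub>v y) ` carrier_vec (rk F (Suc (Suc i))))"

text \<open>\<open>\<mm>\<^sup>k R\<^sup>r\<close>.\<close>

definition max_power_free :: "nat \<Rightarrow> nat \<Rightarrow> ('v, 'k::field) mpoly vec set" where
  "max_power_free k r = {x \<in> carrier_vec r. \<forall>j<r. x $ j \<in> ideal_power max_ideal k}"

definition minimal_complex :: "('v::finite, 'k::field) mpoly free_complex \<Rightarrow> bool" where
  "minimal_complex F \<longleftrightarrow>
     (\<forall>i. (\<lambda>x. diff F i *\<^sub>v x) ` carrier_vec (rk F (Suc i)) \<subseteq> max_power_free 1 (rk F i))"

text \<open>The \<open>p\<close>-th filtration subcomplex in homological degree \<open>i\<close>: it is \<open>\<mm>\<^bsup>p-i\<^esup> F\<^sub>i\<close> for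
  \<open>i \<le> p\<close> and all of \<open>F\<^sub>i\<close> for \<open>i \<ge> p\<close>, which truncated subtraction expresses uniformly.\<close>

definition filt :: "('v::finite, 'k::field) mpoly free_complex \<Rightarrow> nat \<Rightarrow> nat \<Rightarrow> ('v, 'k) mpoly vec set" where
  "filt F p i = max_power_free (p - i) (rk F i)"

text \<open>The quotient of the \<open>p\<close>-th by the \<open>(p+1)\<close>-st filtration step in homological degree \<open>i\<close>,
  as a set of cosets.\<close>

definition gr :: "('v::finite, 'k::field) mpoly free_complex \<Rightarrow> nat \<Rightarrow> nat \<Rightarrow> ('v, 'k) mpoly vec set set" where
  "gr F p i = (\<lambda>x. {x + y | y. y \<in> filt F (Suc p) i}) ` filt F p i"

text \<open>The linear part: in each homological degree the direct sum over \<open>p\<close> of these quotients,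
  i.e. families of cosets almost all of which are zero, with the induced differential.\<close>

definition lin_part ::
    "('v::finite, 'k::field) mpoly free_complex \<Rightarrow> nat \<Rightarrow> (nat \<Rightarrow> ('v, 'k) mpoly vec set) set" where
  "lin_part F i = {X. (\<forall>p. X p \<in> gr F p i) \<and> finite {p. X p \<noteq> filt F (Suc p) i}}"

definition lin_diff ::
    "('v::finite, 'k::field) mpoly free_complex \<Rightarrow> nat \<Rightarrow>
     (nat \<Rightarrow> ('v, 'k) mpoly vec set) \<Rightarrow> (nat \<Rightarrow> ('v, 'k) mpoly vec set)" where
  "lin_diff F i X = (\<lambda>p. {diff F i *\<^sub>v x + y | x y. x \<in> X p \<and> y \<in> filt F (Suc p) i})"

fun lin_cycles ::
    "('v::finite, 'k::field) mpoly free_complex \<Rightarrow> nat \<Rightarrow> (nat \<Rightarrow> ('v, 'k) mpoly vec set) set" where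
  "lin_cycles F 0 = lin_part F 0"
| "lin_cycles F (Suc i) =
     {X \<in> lin_part F (Suc i). lin_diff F i X = (\<lambda>p. filt F (Suc p) i)}"

definition lin_boundaries ::
    "('v::finite, 'k::field) mpoly free_complex \<Rightarrow> nat \<Rightarrow> (nat \<Rightarrow> ('v, 'k) mpoly vec set) set" where
  "lin_boundaries F i = lin_diff F i ` lin_part F (Suc i)"

text \<open>For a minimal complex the boundaries lie among the cycles, so the homology of the linear
  part in degree \<open>i\<close> is nonzero iff the two differ. The supremum of the empty set is 0 here;
  it only occurs for the zero module.\<close>

definition linearity_defect :: "('v::finite, 'k::field) mpoly free_complex \<Rightarrow> enat" where
  "linearity_defect F = Sup {enat i | i. lin_cycles F i \<noteq> lin_boundaries F i}"

text \<open>The minimal graded free resolution is unique up to isomorphism, so the linearity defect of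
  \<open>I\<close> may be read off from any one of them.\<close>

definition koszul :: "('v::finite, 'k::field) mpoly set \<Rightarrow> bool" where
  "koszul I \<longleftrightarrow>
     (\<exists>F g. graded_free_resolution F g I \<and> minimal_complex F \<and> linearity_defect F = 0)"

definition simple_graph :: "'v set \<Rightarrow> 'v set set \<Rightarrow> bool" where
  "simple_graph V E \<longleftrightarrow> finite V \<and> (\<forall>e\<in>E. e \<subseteq> V \<and> card e = 2)"

text \<open>The set \<open>W\<close> consists of the new vertices, and \<open>w \<in> W\<close> is a pendant at \<open>f w\<close>; each vertex
  of \<open>VH\<close> receives at least one pendant.\<close>

definition adds_pendants :: "'v set \<Rightarrow> 'v set set \<Rightarrow> 'v set \<Rightarrow> 'v set set \<Rightarrow> bool" where
  "adds_pendants VH EH VG EG \<longleftrightarrow>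
     (\<exists>W f. finite W \<and> W \<inter> VH = {} \<and> f ` W = VH \<and>
        VG = VH \<union> W \<and> EG = EH \<union> {{f w, w} | w. w \<in> W})"

text \<open>For a graph whose vertex set is all of \<open>'v\<close>, with edge set \<open>E\<close>.\<close>

definition cover_ideal :: "'v set set \<Rightarrow> ('v, 'k::field) mpoly set" where
  "cover_ideal E = \<Inter>{ideal_span {var u, var v} | u v. {u, v} \<in> E}"

end

theory Submission
  imports Defs "HOL-Library.Countable"
begin

text \<open>Let \<open>X\<close> be the vertex set of \<open>H\<close>, and for \<open>h \<in> X\<close> let \<open>y\<^sub>h\<close> be the product of the variables of the
pendants at \<open>h\<close>. A monomial lies in \<open>J(G)\<^bsup>(n)\<^esup>\<close> iff its exponents at the two ends of every edge sum
to at least \<open>n\<close>. Recording for each \<open>h\<close> the deficit \<open>b\<^sub>h\<close> by which the exponent of \<open>x\<^sub>h\<close> falls short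
of \<open>n\<close>, the pendants at \<open>h\<close> must occur to the power \<open>b\<^sub>h\<close> at least, so the ideal is generated by the
monomials \<open>u\<^sub>b = \<Prod>\<^sub>h x\<^sub>h\<^bsup>n - b\<^sub>h\<^esup> y\<^sub>h\<^bsup>b\<^sub>h\<^esup>\<close>, where \<open>b\<close> ranges over the set \<open>D\<close> of vectors
with \<open>b\<^sub>h \<le> n\<close> and \<open>b\<^sub>u + b\<^sub>v \<le> n\<close> on the edges of \<open>H\<close>. This set is closed downwards.

The generators are connected by the relations \<open>x\<^sub>h u\<^sub>b = y\<^sub>h u\<^bsub>b - e\<^sub>h\<^esub>\<close>, and they have linear
quotients: the colon ideal of \<open>u\<^sub>b\<close> by the other generators of no larger total deficit is generated
by the variables \<open>x\<^sub>h\<close> with \<open>b\<^sub>h > 0\<close>. This yields an explicit free resolution, minimal because its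
entries \<open>x\<^sub>h\<close> and \<open>y\<^sub>h\<close> have positive degree. It has a basis element for each pair of
some \<open>b \<in> D\<close> and a set \<open>S\<close> of vertices with positive deficit, and its differential sends \<open>(b, S)\<close> to the signed sum over \<open>h \<in> S\<close> of
\<open>x\<^sub>h (b, S - {h}) - y\<^sub>h (b - e\<^sub>h, S - {h})\<close>. Without the \<open>y\<^sub>h\<close> terms this is a direct sum of
Koszul complexes on variables; the \<open>y\<^sub>h\<close> terms lower the total deficit.

The decisive point is that the same complex with \<^emph>\<open>arbitrary\<close> coefficients \<open>c\<^sub>h\<close> in place of
\<open>y\<^sub>h\<close> has no homology in positive degrees (\<open>twisted_diff_exact\<close>), by filtering along the total
deficit and using exactness of the Koszul complex (\<open>koszul_exact\<close>). Taking \<open>c\<^sub>h = y\<^sub>h\<close> gives,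
together with \<open>augment_exact\<close> in degree 0, the resolution. Taking \<open>c\<^sub>h = y\<^sub>h\<close> where \<open>h\<close> has exactly
one pendant and \<open>c\<^sub>h = 0\<close> elsewhere gives its linear part, which is therefore acyclic as well: this is
the Koszul property.

That \<open>J(G)\<^bsup>(n)\<^esup>\<close> is this monomial ideal is an instance of \<open>symbolic_power_inter_primes\<close>. It rests on
the fact that the ideals \<open>(x\<^sub>v : v \<in> e)\<^bsup>n\<^esup>\<close> are primary, which is proved by comparing
terms of lowest weight.\<close>

section \<open>Monomial ideals\<close>

abbreviation mon :: "('v \<Rightarrow>\<^sub>0 nat) \<Rightarrow> ('v, 'k::field) mpoly" where
  "mon m \<equiv> Poly_Mapping.single m 1"

lemma module_mult: "Modules.module ((*) :: 'r::comm_ring_1 \<Rightarrow> 'r \<Rightarrow> 'r)"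
  by unfold_locales (auto simp: algebra_simps)

lemmas is_ideal_def = module.subspace_def[OF module_mult]

lemma lookup_single_times:
  fixes p :: "'a::cancel_comm_monoid_add \<Rightarrow>\<^sub>0 'b::comm_semiring_0"
  shows "Poly_Mapping.lookup (Poly_Mapping.single a c * p) (a + m) = c * Poly_Mapping.lookup p m"
proof -
  show ?thesis
    unfolding lookup_mult lookup_single
    by (simp add: when_mult)
qed

lemma keys_single_times:
  fixes p :: "('v, 'k::field) mpoly"
  shows "Poly_Mapping.keys (mon a * p) = (+) a ` Poly_Mapping.keys p"
proof
  show "Poly_Mapping.keys (mon a * p) \<subseteq> (+) a ` Poly_Mapping.keys p"
    using keys_mult[of "mon a" p] by auto
  show "(+) a ` Poly_Mapping.keys p \<subseteq> Poly_Mapping.keys (mon a * p)"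
    by (auto simp: in_keys_iff lookup_single_times)
qed

lemma poly_eq_sum_singles:
  "p = (\<Sum>m\<in>Poly_Mapping.keys p. Poly_Mapping.single m (Poly_Mapping.lookup p m))"
  by (rule poly_mapping_eqI)
     (auto simp: lookup_sum lookup_single when_def sum.delta in_keys_iff)

lemma mon_divides_lookup:
  assumes "\<And>v. Poly_Mapping.lookup a v \<le> Poly_Mapping.lookup m v"
  shows "\<exists>r. m = a + (r :: 'v \<Rightarrow>\<^sub>0 nat)"
  using assms by (intro exI[of _ "m - a"] poly_mapping_eqI) (simp add: lookup_add lookup_minus)

definition mono_ideal :: "('v \<Rightarrow>\<^sub>0 nat) set \<Rightarrow> ('v, 'k::field) mpoly set" where
  "mono_ideal U = {p. Poly_Mapping.keys p \<subseteq> U}"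

lemma mono_ideal_is_ideal:
  assumes "\<And>m r. m \<in> U \<Longrightarrow> m + r \<in> U"
  shows "is_ideal (mono_ideal U)"
  unfolding is_ideal_def
proof (intro conjI allI ballI)
  show "0 \<in> mono_ideal U" by (simp add: mono_ideal_def)
  fix x y :: "('a, 'b) mpoly" and c
  assume x: "x \<in> mono_ideal U"
  { assume y: "y \<in> mono_ideal U"
    show "x + y \<in> mono_ideal U"
      using x y keys_add[of x y] by (auto simp: mono_ideal_def) }
  show "c * x \<in> mono_ideal U"
  proof -
    have "m \<in> U" if m: "m \<in> Poly_Mapping.keys (c * x)" for m
    proof -
      obtain a b where "m = b + a" "b \<in> Poly_Mapping.keys x"
        using m keys_mult[of c x] by (auto simp: add.commute)
      with x assms show ?thesis by (auto simp: mono_ideal_def)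
    qed
    then show ?thesis by (auto simp: mono_ideal_def)
  qed
qed

text \<open>Each term of \<open>p\<close> is assigned to one generator that divides it; collecting the quotients generator
by generator gives the coefficients.\<close>

lemma mono_ideal_combination:
  fixes p :: "('v, 'k::field) mpoly"
  assumes B: "finite B" and p: "\<And>m. m \<in> Poly_Mapping.keys p \<Longrightarrow> \<exists>b\<in>B. \<exists>r. m = u b + r"
  shows "\<exists>q. p = (\<Sum>b\<in>B. mon (u b) * q b)"
proof -
  from p obtain \<beta> r where br: "\<And>m. m \<in> Poly_Mapping.keys p \<Longrightarrow> \<beta> m \<in> B \<and> m = u (\<beta> m) + r m"
    by metis
  define q where "q b = (\<Sum>m | m \<in> Poly_Mapping.keys p \<and> \<beta> m = b. Poly_Mapping.single (r m) (Poly_Mapping.lookup p m))" for b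
  have "p = (\<Sum>m\<in>Poly_Mapping.keys p. Poly_Mapping.single m (Poly_Mapping.lookup p m))"
    by (rule poly_eq_sum_singles)
  also have "\<dots> = (\<Sum>b\<in>B. \<Sum>m | m \<in> Poly_Mapping.keys p \<and> \<beta> m = b. Poly_Mapping.single m (Poly_Mapping.lookup p m))"
    by (rule sum.group[symmetric]) (use B br in auto)
  also have "\<dots> = (\<Sum>b\<in>B. mon (u b) * q b)"
    unfolding q_def sum_distrib_left
    by (intro sum.cong refl) (use br in \<open>auto simp: mult_single\<close>)
  finally show ?thesis by blast
qed

lemma mono_ideal_subset_ideal:
  fixes I :: "('v, 'k::field) mpoly set"
  assumes I: "is_ideal I" and gen: "\<And>m. m \<in> U \<Longrightarrow> mon m \<in> I"
  shows "mono_ideal U \<subseteq> I"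
proof
  fix p :: "('v, 'k) mpoly" assume p: "p \<in> mono_ideal U"
  have "Poly_Mapping.single 0 (Poly_Mapping.lookup p m) * mon m \<in> I" if "m \<in> Poly_Mapping.keys p" for m
    using that p gen I by (auto simp: mono_ideal_def is_ideal_def)
  then have "Poly_Mapping.single m (Poly_Mapping.lookup p m) \<in> I" if "m \<in> Poly_Mapping.keys p" for m
    using that by (simp add: mult_single)
  then have "(\<Sum>m\<in>Poly_Mapping.keys p. Poly_Mapping.single m (Poly_Mapping.lookup p m)) \<in> I"
    by (intro module.subspace_sum[OF module_mult I])
  then show "p \<in> I" using poly_eq_sum_singles[of p] by simp
qed

text \<open>For \<open>Y = UNIV\<close> this is the degree of a monomial; for an edge \<open>Y = {u, v}\<close> it is the order of the
monomial along the prime \<open>(x\<^sub>u, x\<^sub>v)\<close>. Both the powers of the maximal ideal and those of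
the minimal primes of a cover ideal are instances of the ideals \<open>wt_ideal Y k\<close> below.\<close>

definition wt :: "'v set \<Rightarrow> ('v \<Rightarrow>\<^sub>0 nat) \<Rightarrow> nat" where
  "wt Y m = (\<Sum>v\<in>Y. Poly_Mapping.lookup m v)"

lemma wt_add [simp]: "wt Y (a + b) = wt Y a + wt Y b"
  by (simp add: wt_def lookup_add sum.distrib)

lemma wt_zero [simp]: "wt Y 0 = 0"
  by (simp add: wt_def)

lemma wt_sum: "wt Y (sum f A) = (\<Sum>a\<in>A. wt Y (f a))"
  by (induction A rule: infinite_finite_induct) auto

lemma wt_single: "finite Y \<Longrightarrow> wt Y (Poly_Mapping.single v k) = (if v \<in> Y then k else 0)"
  by (simp add: wt_def lookup_single when_def)

lemma mdeg_eq_wt: "mdeg m = wt UNIV m"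
  by (simp add: mdeg_def wt_def)

text \<open>The reason why monomials of weight at least \<open>k\<close> lie in the \<open>k\<close>-th power of \<open>(x\<^sub>v : v \<in> Y)\<close>.\<close>

lemma wt_decompose:
  assumes Y: "finite Y"
  shows "k \<le> wt Y m \<Longrightarrow> \<exists>v r. (\<forall>i<k. v i \<in> Y) \<and> m = (\<Sum>i<k. Poly_Mapping.single (v i) 1) + r"
proof (induction k)
  case 0
  then show ?case by auto
next
  case (Suc k)
  then obtain v r where v: "\<forall>i<k. v i \<in> Y" and m: "m = (\<Sum>i<k. Poly_Mapping.single (v i) 1) + r"
    by auto
  have "wt Y (\<Sum>i<k. Poly_Mapping.single (v i) 1) = k"
    using v Y by (simp add: wt_sum wt_single)
  with Suc.prems m have "wt Y r \<noteq> 0" by auto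
  then obtain w where w: "w \<in> Y" "Poly_Mapping.lookup r w \<noteq> 0"
    unfolding wt_def by (meson sum.neutral)
  then obtain r' where r': "r = Poly_Mapping.single w 1 + r'"
    using mon_divides_lookup[of "Poly_Mapping.single w 1" r]
    by (metis lookup_single_eq lookup_single_not_eq One_nat_def Suc_leI le0 not_gr_zero)
  have "(\<Sum>i<Suc k. Poly_Mapping.single ((v(k := w)) i) (1::nat)) = (\<Sum>i<k. Poly_Mapping.single (v i) 1) + Poly_Mapping.single w 1"
    by simp
  then have "m = (\<Sum>i<Suc k. Poly_Mapping.single ((v(k := w)) i) 1) + r'"
    using m r' by (simp add: add.assoc)
  moreover have "\<forall>i<Suc k. (v(k := w)) i \<in> Y" using v w by (auto simp: less_Suc_eq)
  ultimately show ?case by blast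
qed

abbreviation wt_ideal :: "'v set \<Rightarrow> nat \<Rightarrow> ('v, 'k::field) mpoly set" where
  "wt_ideal Y k \<equiv> mono_ideal {m. k \<le> wt Y m}"

lemma wt_ideal_is_ideal: "is_ideal (wt_ideal Y k)"
  by (rule mono_ideal_is_ideal) auto

lemma wt_ideal_mult:
  assumes "p \<in> wt_ideal Y i" "q \<in> wt_ideal Y j"
  shows "p * q \<in> wt_ideal Y (i + j)"
proof -
  have "i + j \<le> wt Y m" if m: "m \<in> Poly_Mapping.keys (p * q)" for m
  proof -
    obtain a b where "m = a + b" "a \<in> Poly_Mapping.keys p" "b \<in> Poly_Mapping.keys q"
      using m keys_mult[of p q] by auto
    with assms show ?thesis by (force simp: mono_ideal_def intro: add_mono)
  qed
  then show ?thesis by (auto simp: mono_ideal_def)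
qed

lemma prod_in_wt_ideal:
  "(\<forall>i<k. f i \<in> wt_ideal Y 1) \<Longrightarrow> (\<Prod>i<k. f i) \<in> wt_ideal Y k"
proof (induction k)
  case 0
  show ?case by (simp add: mono_ideal_def)
next
  case (Suc k)
  then have "(\<Prod>i<k. f i) * f k \<in> wt_ideal Y (k + 1)"
    by (intro wt_ideal_mult) auto
  then show ?case by simp
qed

lemma mon_sum: "finite A \<Longrightarrow> mon (sum f A) = (\<Prod>a\<in>A. mon (f a) :: ('v, 'k::field) mpoly)"
proof (induction A rule: finite_induct)
  case (insert a A)
  have "mon (sum f (insert a A)) = mon (f a) * (mon (sum f A) :: ('v, 'k) mpoly)"
    using insert.hyps by (simp add: mult_single)
  with insert show ?case by simp
qed simp

lemma ideal_power_wt_ideal: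
  assumes Y: "finite Y"
  shows "ideal_power (wt_ideal Y 1) k = (wt_ideal Y k :: ('v, 'k::field) mpoly set)"
proof
  show "ideal_power (wt_ideal Y 1) k \<subseteq> (wt_ideal Y k :: ('v, 'k) mpoly set)"
    unfolding ideal_power_def
    by (rule module.span_minimal[OF module_mult]) (use prod_in_wt_ideal in \<open>blast intro: wt_ideal_is_ideal\<close>)+
  show "(wt_ideal Y k :: ('v, 'k) mpoly set) \<subseteq> ideal_power (wt_ideal Y 1) k"
  proof (rule mono_ideal_subset_ideal)
    show id: "is_ideal (ideal_power (wt_ideal Y 1) k :: ('v, 'k) mpoly set)"
      unfolding ideal_power_def by (rule module.subspace_span[OF module_mult])
    fix m assume "m \<in> {m. k \<le> wt Y m}"
    then obtain v r where v: "\<forall>i<k. v i \<in> Y" and m: "m = (\<Sum>i<k. Poly_Mapping.single (v i) 1) + r"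
      using wt_decompose[OF Y, of k m] by auto
    have *: "(\<Prod>i<k. mon (Poly_Mapping.single (v i) 1)) \<in> (ideal_power (wt_ideal Y 1) k :: ('v, 'k) mpoly set)"
      unfolding ideal_power_def
      by (rule module.span_base[OF module_mult]) (use v Y in \<open>auto simp: mono_ideal_def wt_single\<close>)
    have "mon m = mon r * (\<Prod>i<k. mon (Poly_Mapping.single (v i) 1) :: ('v, 'k) mpoly)"
      unfolding m by (simp add: mon_sum[symmetric] mult_single add.commute)
    with * id show "mon m \<in> (ideal_power (wt_ideal Y 1) k :: ('v, 'k) mpoly set)"
      by (simp add: is_ideal_def)
  qed
qed

lemma ideal_span_vars:
  assumes Y: "finite Y"
  shows "ideal_span (var ` Y) = (wt_ideal Y 1 :: ('v, 'k::field) mpoly set)"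
proof
  show "ideal_span (var ` Y) \<subseteq> (wt_ideal Y 1 :: ('v, 'k::field) mpoly set)"
    by (rule module.span_minimal[OF module_mult])
       (auto simp: wt_ideal_is_ideal, auto simp: mono_ideal_def var_def wt_single Y)
  show "(wt_ideal Y 1 :: ('v, 'k::field) mpoly set) \<subseteq> ideal_span (var ` Y)"
  proof (rule mono_ideal_subset_ideal)
    show id: "is_ideal (ideal_span (var ` Y) :: ('v, 'k) mpoly set)"
      by (rule module.subspace_span[OF module_mult])
    fix m assume "m \<in> {m. 1 \<le> wt Y m}"
    then obtain v r where v: "v \<in> Y" and m: "m = Poly_Mapping.single v 1 + r"
      using wt_decompose[OF Y, of 1 m] by auto
    have "var v \<in> (ideal_span (var ` Y) :: ('v, 'k) mpoly set)"
      by (rule module.span_base[OF module_mult]) (use v in auto)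
    moreover have "mon m = mon r * (var v :: ('v, 'k) mpoly)"
      by (simp add: m mult_single var_def add.commute)
    ultimately show "mon m \<in> (ideal_span (var ` Y) :: ('v, 'k) mpoly set)"
      using id by (simp add: is_ideal_def)
  qed
qed

lemma ideal_power_max_ideal:
  "ideal_power max_ideal k = (wt_ideal UNIV k :: ('v::finite, 'k::field) mpoly set)"
  unfolding max_ideal_def ideal_span_vars[OF finite_UNIV] ideal_power_wt_ideal[OF finite_UNIV] ..

section \<open>Primary decomposition of symbolic powers\<close>

lemma poly_mapping_le_imp_lookup_0_le:
  fixes a b :: "nat \<Rightarrow>\<^sub>0 nat"
  assumes "a \<le> b"
  shows "Poly_Mapping.lookup a 0 \<le> Poly_Mapping.lookup b 0"
proof (cases "a = b")
  case False
  with assms have "a < b" by simp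
  then obtain k where "Poly_Mapping.lookup a k < Poly_Mapping.lookup b k"
     "\<And>k'. k' < k \<Longrightarrow> Poly_Mapping.lookup a k' = Poly_Mapping.lookup b k'"
    by (auto simp: less_poly_mapping.rep_eq less_fun_def)
  then show ?thesis by (cases k) (auto simp: le_eq_less_or_eq)
qed simp

text \<open>The terms of \<open>f\<close> and \<open>g\<close> that are lowest in a total order compatible with multiplication cannot
cancel in the product. For that order to refine the weight along \<open>Y\<close>, monomials are embedded
into \<open>nat \<Rightarrow>\<^sub>0 nat\<close>, which is ordered lexicographically from index 0 on, with the weight placed at
index 0.\<close>

lemma lowest_term_mult:
  fixes f g :: "('v::finite, 'k::field) mpoly"
  assumes "f \<noteq> 0" "g \<noteq> 0"
  obtains a b where "a \<in> Poly_Mapping.keys f" "b \<in> Poly_Mapping.keys g" "a + b \<in> Poly_Mapping.keys (f * g)"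
    "\<And>a'. a' \<in> Poly_Mapping.keys f \<Longrightarrow> wt Y a \<le> wt Y a'" "\<And>b'. b' \<in> Poly_Mapping.keys g \<Longrightarrow> wt Y b \<le> wt Y b'"
proof -
  define \<kappa> :: "('v \<Rightarrow>\<^sub>0 nat) \<Rightarrow> (nat \<Rightarrow>\<^sub>0 nat)" where
    "\<kappa> m = Poly_Mapping.single 0 (wt Y m) + (\<Sum>v\<in>UNIV. Poly_Mapping.single (Suc (to_nat v)) (Poly_Mapping.lookup m v))" for m
  have \<kappa>_add: "\<kappa> (a + b) = \<kappa> a + \<kappa> b" for a b
    by (simp add: \<kappa>_def single_add lookup_add sum.distrib algebra_simps)
  have l: "Poly_Mapping.lookup (\<kappa> m) (Suc (to_nat v)) = Poly_Mapping.lookup m v" for m v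
    by (simp add: \<kappa>_def lookup_add lookup_sum lookup_single when_def)
  have l0: "Poly_Mapping.lookup (\<kappa> m) 0 = wt Y m" for m
    by (simp add: \<kappa>_def lookup_add lookup_sum lookup_single when_def)
  have inj: "a = b" if "\<kappa> a = \<kappa> b" for a b
    using that l by (metis poly_mapping_eqI)
  have ex: "\<exists>a\<in>Poly_Mapping.keys h. \<forall>a'\<in>Poly_Mapping.keys h. \<kappa> a \<le> \<kappa> a'" if "h \<noteq> 0" for h :: "('v, 'k) mpoly"
  proof -
    have "Min (\<kappa> ` Poly_Mapping.keys h) \<in> \<kappa> ` Poly_Mapping.keys h"
      using that by (intro Min_in) auto
    then obtain a where "a \<in> Poly_Mapping.keys h" "\<kappa> a = Min (\<kappa> ` Poly_Mapping.keys h)" by auto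
    then show ?thesis by (metis Min_le finite_imageI finite_keys image_eqI)
  qed
  obtain a where a: "a \<in> Poly_Mapping.keys f" "\<And>a'. a' \<in> Poly_Mapping.keys f \<Longrightarrow> \<kappa> a \<le> \<kappa> a'" using ex[OF assms(1)] by auto
  obtain b where b: "b \<in> Poly_Mapping.keys g" "\<And>b'. b' \<in> Poly_Mapping.keys g \<Longrightarrow> \<kappa> b \<le> \<kappa> b'" using ex[OF assms(2)] by auto
  define c d where "c = Poly_Mapping.lookup f a" and "d = Poly_Mapping.lookup g b"
  define f' g' where "f' = f - Poly_Mapping.single a c" and "g' = g - Poly_Mapping.single b d"
  have f': "a' \<in> Poly_Mapping.keys f \<and> a' \<noteq> a" if "a' \<in> Poly_Mapping.keys f'" for a'
    using that by (cases "a' = a") (auto simp: f'_def c_def in_keys_iff lookup_minus lookup_single when_def)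
  have g': "b' \<in> Poly_Mapping.keys g \<and> b' \<noteq> b" if "b' \<in> Poly_Mapping.keys g'" for b'
    using that by (cases "b' = b") (auto simp: g'_def d_def in_keys_iff lookup_minus lookup_single when_def)
  have "f * g = Poly_Mapping.single (a + b) (c * d) + Poly_Mapping.single a c * g' + f' * g"
    by (simp add: f'_def g'_def algebra_simps mult_single)
  moreover have "a + b \<notin> Poly_Mapping.keys (Poly_Mapping.single a c * g')"
  proof
    assume "a + b \<in> Poly_Mapping.keys (Poly_Mapping.single a c * g')"
    then obtain b' where "b' \<in> Poly_Mapping.keys g'" "a + b = a + b'"
      using keys_mult[of "Poly_Mapping.single a c" g'] by (auto split: if_splits)
    with g' show False by auto
  qed
  moreover have "a + b \<notin> Poly_Mapping.keys (f' * g)"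
  proof
    assume "a + b \<in> Poly_Mapping.keys (f' * g)"
    then obtain a' b' where "a' \<in> Poly_Mapping.keys f'" "b' \<in> Poly_Mapping.keys g" "a + b = a' + b'"
      using keys_mult[of f' g] by auto
    with f' a b inj have "\<kappa> a < \<kappa> a'" "\<kappa> b \<le> \<kappa> b'" "\<kappa> a + \<kappa> b = \<kappa> a' + \<kappa> b'"
      by (force simp: order.strict_iff_order \<kappa>_add[symmetric])+
    then show False using add_less_le_mono[of "\<kappa> a" "\<kappa> a'" "\<kappa> b" "\<kappa> b'"] by simp
  qed
  ultimately have "Poly_Mapping.lookup (f * g) (a + b) = c * d"
    by (simp add: lookup_add in_keys_iff)
  then have "a + b \<in> Poly_Mapping.keys (f * g)"
    using a b by (simp add: in_keys_iff c_def d_def)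
  then show thesis
    using that a b poly_mapping_le_imp_lookup_0_le l0 by metis
qed

text \<open>Since \<open>s\<close> lies outside the prime, its lowest term has weight 0, so the lowest weights of \<open>f\<close> and of
\<open>f * s\<close> agree.\<close>

lemma wt_ideal_primary:
  fixes f s :: "('v::finite, 'k::field) mpoly"
  assumes fs: "f * s \<in> wt_ideal Y n" and s: "s \<notin> wt_ideal Y 1"
  shows "f \<in> wt_ideal Y n"
proof (cases "f = 0")
  case True
  then show ?thesis by (simp add: mono_ideal_def)
next
  case False
  have "s \<noteq> 0" using s by (auto simp: mono_ideal_def)
  obtain a b where ab: "a \<in> Poly_Mapping.keys f" "b \<in> Poly_Mapping.keys s" "a + b \<in> Poly_Mapping.keys (f * s)"
    "\<And>a'. a' \<in> Poly_Mapping.keys f \<Longrightarrow> wt Y a \<le> wt Y a'" "\<And>b'. b' \<in> Poly_Mapping.keys s \<Longrightarrow> wt Y b \<le> wt Y b'"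
    by (rule lowest_term_mult[OF False \<open>s \<noteq> 0\<close>, of Y]) blast
  have "wt Y b = 0" using s ab(5) by (fastforce simp: mono_ideal_def not_le)
  moreover have "n \<le> wt Y (a + b)" using fs ab(3) by (auto simp: mono_ideal_def)
  ultimately show ?thesis using ab(4) by (force simp: mono_ideal_def)
qed

lemma wt_ideal_prime: "prime_ideal (wt_ideal Y 1 :: ('v::finite, 'k::field) mpoly set)"
proof -
  have "(1 :: ('v, 'k) mpoly) \<notin> wt_ideal Y 1" by (simp add: mono_ideal_def)
  then show ?thesis
    using wt_ideal_is_ideal wt_ideal_primary[where Y = Y and n = 1] unfolding prime_ideal_def by blast
qed

lemma prime_ideal_prod:
  assumes P: "prime_ideal P" and S: "finite S" and "prod f S \<in> P"
  shows "\<exists>s\<in>S. f s \<in> P"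
proof -
  have 1: "1 \<notin> P"
  proof
    assume "1 \<in> P"
    then have "c * 1 \<in> P" for c using P unfolding prime_ideal_def is_ideal_def by blast
    then show False using P by (auto simp: prime_ideal_def)
  qed
  show ?thesis using S assms(3)
    by (induction S rule: finite_induct) (use P 1 in \<open>auto simp: prime_ideal_def\<close>)
qed

text \<open>A prime containing the intersection of the primes \<open>(x\<^sub>v : v \<in> e)\<close> contains one of them, and these are
pairwise incomparable because \<open>E\<close> is an antichain; so they are the minimal primes. Locally at \<open>e\<close>
the variables outside \<open>e\<close> are units, and each other member of \<open>E\<close> contains such a variable, whence
the ideal becomes \<open>(x\<^sub>v : v \<in> e)\<close>.\<close>

lemma symbolic_power_inter_primes:
  fixes E :: "'v::finite set set"
  assumes nonempty: "\<And>e. e \<in> E \<Longrightarrow> e \<noteq> {}"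
    and antichain: "\<And>e e'. e \<in> E \<Longrightarrow> e' \<in> E \<Longrightarrow> e' \<subseteq> e \<Longrightarrow> e' = e"
  shows "symbolic_power (mono_ideal {m. \<forall>e\<in>E. 1 \<le> wt e m}) n
      = (mono_ideal {m. \<forall>e\<in>E. n \<le> wt e m} :: ('v, 'k::field) mpoly set)"
proof -
  define J :: "('v, 'k) mpoly set" where "J = mono_ideal {m. \<forall>e\<in>E. 1 \<le> wt e m}"
  have J_id: "is_ideal J" unfolding J_def by (rule mono_ideal_is_ideal) (auto simp: trans_le_add1)
  have J_le: "J \<subseteq> wt_ideal e 1" if "e \<in> E" for e using that by (auto simp: J_def mono_ideal_def)
  have contains: "\<exists>e\<in>E. wt_ideal e 1 \<subseteq> Q" if Q: "prime_ideal Q" "J \<subseteq> Q" for Q :: "('v, 'k) mpoly set"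
  proof (rule ccontr)
    assume "\<not> ?thesis"
    have "\<exists>v\<in>e. var v \<notin> Q" if "e \<in> E" for e
    proof (rule ccontr)
      assume "\<not> (\<exists>v\<in>e. var v \<notin> Q)"
      then have "ideal_span (var ` e) \<subseteq> Q"
        using Q(1) by (intro module.span_minimal[OF module_mult]) (auto simp: prime_ideal_def)
      with \<open>\<not> (\<exists>e\<in>E. wt_ideal e 1 \<subseteq> Q)\<close> that show False by (simp add: ideal_span_vars)
    qed
    then obtain v where v: "\<And>e. e \<in> E \<Longrightarrow> v e \<in> e \<and> var (v e) \<notin> Q" by metis
    \<comment> \<open>The product of one variable outside \<open>Q\<close> from each member of \<open>E\<close> would lie in \<open>J\<close>.\<close>
    have "1 \<le> wt e (\<Sum>e\<in>E. Poly_Mapping.single (v e) 1)" if "e \<in> E" for e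
    proof -
      have "wt e (Poly_Mapping.single (v e) 1) \<le> (\<Sum>e'\<in>E. wt e (Poly_Mapping.single (v e') 1))"
        by (rule member_le_sum) (use that in auto)
      then show ?thesis using v[OF that] by (simp add: wt_sum wt_single)
    qed
    then have "mon (\<Sum>e\<in>E. Poly_Mapping.single (v e) 1) \<in> J"
      by (simp add: J_def mono_ideal_def)
    then have "(\<Prod>e\<in>E. var (v e)) \<in> Q" using Q(2) by (auto simp: mon_sum var_def)
    then have "\<exists>e\<in>E. var (v e) \<in> Q" by (intro prime_ideal_prod[OF Q(1)]) auto
    with v show False by blast
  qed
  have le_iff: "e \<subseteq> e'" if "wt_ideal e 1 \<subseteq> (wt_ideal e' 1 :: ('v, 'k) mpoly set)" for e e'
  proof
    fix v assume "v \<in> e"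
    then have "var v \<in> (wt_ideal e 1 :: ('v, 'k) mpoly set)" by (simp add: mono_ideal_def var_def wt_single)
    with that have "var v \<in> (wt_ideal e' 1 :: ('v, 'k) mpoly set)" by blast
    then show "v \<in> e'" by (simp add: mono_ideal_def var_def wt_single split: if_splits)
  qed
  have min: "minimal_primes J = (\<lambda>e. wt_ideal e 1) ` E"
  proof (intro equalityI subsetI)
    fix P assume P: "P \<in> minimal_primes J"
    then obtain e where "e \<in> E" "wt_ideal e 1 \<subseteq> P" using contains[of P] by (auto simp: minimal_primes_def)
    moreover from this P have "wt_ideal e 1 = P"
      using wt_ideal_prime[of e] J_le[of e] unfolding minimal_primes_def by blast
    ultimately show "P \<in> (\<lambda>e. wt_ideal e 1) ` E" by blast
  next
    fix P :: "('v, 'k) mpoly set" assume "P \<in> (\<lambda>e. wt_ideal e 1) ` E"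
    then obtain e where e: "e \<in> E" and P: "P = wt_ideal e 1" by blast
    have "Q = P" if Q: "prime_ideal Q" "J \<subseteq> Q" "Q \<subseteq> P" for Q
    proof -
      obtain e' where e': "e' \<in> E" "wt_ideal e' 1 \<subseteq> Q" using contains[OF Q(1,2)] by blast
      with Q(3) P le_iff have "e' \<subseteq> e" by (metis order_trans)
      with antichain e e' have "e' = e" by blast
      with e' Q(3) P show ?thesis by blast
    qed
    then show "P \<in> minimal_primes J"
      using e P J_le[of e] wt_ideal_prime[of e] by (auto simp: minimal_primes_def)
  qed
  have contr: "local_contraction (wt_ideal e 1) (ideal_power J n) = wt_ideal e n" if e: "e \<in> E" for e
  proof (intro equalityI subsetI)
    fix f assume "f \<in> local_contraction (wt_ideal e 1) (ideal_power J n)"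
    then obtain a s u where a: "a \<in> ideal_power J n" and s: "s \<notin> wt_ideal e 1" and u: "u \<notin> wt_ideal e 1"
      and eq: "u * (f * s - a * 1) = 0"
      by (auto simp: local_contraction_def frac_eq_at_def)
    have "ideal_power J n \<subseteq> ideal_power (wt_ideal e 1) n"
      unfolding ideal_power_def using J_le[OF e] by (intro module.span_mono[OF module_mult]) blast
    with a have "a \<in> wt_ideal e n" unfolding ideal_power_wt_ideal[OF finite] by blast
    then have "u * a \<in> wt_ideal e n" using wt_ideal_is_ideal unfolding is_ideal_def by blast
    moreover have "f * (s * u) = u * a" using eq by (simp add: algebra_simps)
    moreover have "s * u \<notin> wt_ideal e 1" using s u wt_ideal_prime[of e] by (auto simp: prime_ideal_def)
    ultimately show "f \<in> wt_ideal e n" using wt_ideal_primary by metis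
  next
    fix f :: "('v, 'k) mpoly" assume f: "f \<in> wt_ideal e n"
    define o' :: "'v \<Rightarrow>\<^sub>0 nat" where "o' = (\<Sum>v\<in>-e. Poly_Mapping.single v 1)"
    \<comment> \<open>\<open>o'\<close> times any variable of \<open>e\<close> lies in \<open>J\<close>, so \<open>n\<close> factors \<open>o'\<close> clear the denominators.\<close>
    define t where "t = (\<Sum>i<n. o')"
    have pid: "is_ideal (ideal_power J n)"
      unfolding ideal_power_def by (rule module.subspace_span[OF module_mult])
    have o_in: "mon (o' + Poly_Mapping.single v 1) \<in> J" if v: "v \<in> e" for v
    proof -
      have "1 \<le> wt e' (o' + Poly_Mapping.single v 1)" if e': "e' \<in> E" for e'
      proof (cases "e' = e")
        case True
        with v show ?thesis by (simp add: wt_single)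
      next
        case False
        then obtain w where w: "w \<in> e'" "w \<notin> e" using antichain[OF e e'] by blast
        have "wt e' (Poly_Mapping.single w 1) \<le> (\<Sum>v\<in>-e. wt e' (Poly_Mapping.single v 1))"
          by (rule member_le_sum) (use w in auto)
        with w show ?thesis by (simp add: o'_def wt_sum wt_single)
      qed
      then show ?thesis by (simp add: J_def mono_ideal_def)
    qed
    have "wt_ideal e n \<subseteq> {f. mon t * f \<in> ideal_power J n}"
    proof (rule mono_ideal_subset_ideal)
      show "is_ideal {f. mon t * f \<in> ideal_power J n}"
        using pid unfolding is_ideal_def by (auto simp: distrib_left mult.left_commute)
      fix m assume "m \<in> {m. n \<le> wt e m}"
      then obtain v r where v: "\<forall>i<n. v i \<in> e" and m: "m = (\<Sum>i<n. Poly_Mapping.single (v i) 1) + r"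
        using wt_decompose[of e n m] by auto
      have "(\<Prod>i<n. mon (o' + Poly_Mapping.single (v i) 1)) \<in> ideal_power J n"
        unfolding ideal_power_def
        by (rule module.span_base[OF module_mult]) (use o_in v in auto)
      then have "mon r * (\<Prod>i<n. mon (o' + Poly_Mapping.single (v i) 1)) \<in> ideal_power J n"
        using pid by (simp add: is_ideal_def)
      moreover have "mon t * mon m = (mon r :: ('v, 'k) mpoly) * (\<Prod>i<n. mon (o' + Poly_Mapping.single (v i) 1))"
        unfolding m t_def mon_sum[OF finite_lessThan, symmetric] sum.distrib mult_single
        by (simp add: algebra_simps)
      ultimately show "mon m \<in> {f. mon t * f \<in> ideal_power J n}" by simp
    qed
    with f have "mon t * f \<in> ideal_power J n" by blast
    moreover have "wt e t = 0" by (simp add: t_def o'_def wt_sum wt_single)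
    then have "mon t \<notin> wt_ideal e 1" by (simp add: mono_ideal_def)
    moreover have "1 \<notin> wt_ideal e 1" by (simp add: mono_ideal_def)
    moreover have "1 * (f * mon t - mon t * f * 1) = 0" by simp
    ultimately show "f \<in> local_contraction (wt_ideal e 1) (ideal_power J n)"
      unfolding local_contraction_def frac_eq_at_def by blast
  qed
  have "symbolic_power J n = (\<Inter>e\<in>E. wt_ideal e n)"
    unfolding symbolic_power_def min using contr by simp
  also have "\<dots> = mono_ideal {m. \<forall>e\<in>E. n \<le> wt e m}"
    by (auto simp: mono_ideal_def)
  finally show ?thesis unfolding J_def .
qed

section \<open>Exactness of the Koszul complex on a set of variables\<close>

text \<open>The sign of removing \<open>h\<close> from \<open>insert h T\<close>, with respect to the order of the vertices that
\<open>to_nat\<close> provides.\<close>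

definition koszul_sign :: "'v::finite \<Rightarrow> 'v set \<Rightarrow> ('v, 'k::field) mpoly" where
  "koszul_sign h T = (- 1) ^ card {s \<in> T. to_nat s < to_nat h}"

lemma koszul_sign_insert:
  assumes "g \<notin> T"
  shows "koszul_sign h (insert g T) = (if to_nat g < to_nat h then - koszul_sign h T else koszul_sign h T)"
proof -
  have "{s \<in> insert g T. to_nat s < to_nat h} =
      (if to_nat g < to_nat h then insert g {s \<in> T. to_nat s < to_nat h} else {s \<in> T. to_nat s < to_nat h})"
    by auto
  with assms show ?thesis by (simp add: koszul_sign_def)
qed

lemma koszul_sign_swap:
  assumes "h \<notin> T" "g \<notin> T" "h \<noteq> g"
  shows "koszul_sign h T * koszul_sign g (insert h T) = - (koszul_sign g T * koszul_sign h (insert g T))"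
proof -
  have "to_nat h \<noteq> to_nat g" using assms(3) by simp
  then have "to_nat h < to_nat g \<and> \<not> to_nat g < to_nat h \<or> to_nat g < to_nat h \<and> \<not> to_nat h < to_nat g"
    by linarith
  then show ?thesis using assms by (auto simp: koszul_sign_insert)
qed

lemma koszul_sign_empty [simp]: "koszul_sign h {} = 1"
  by (simp add: koszul_sign_def)

text \<open>The Koszul differential, on chains given by their coefficients at the sets of variables.\<close>

definition koszul_diff :: "('v::finite set \<Rightarrow> ('v, 'k::field) mpoly) \<Rightarrow> 'v set \<Rightarrow> ('v, 'k) mpoly" where
  "koszul_diff z T = (\<Sum>h\<in>-T. koszul_sign h T * var h * z (insert h T))"

lemma combination_of_vars:
  fixes p :: "('v::finite, 'k::field) mpoly"
  assumes "\<And>m. m \<in> Poly_Mapping.keys p \<Longrightarrow> \<exists>h\<in>Y. 0 < Poly_Mapping.lookup m h"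
  shows "\<exists>q. p = (\<Sum>h\<in>Y. var h * q h)"
  unfolding var_def
proof (rule mono_ideal_combination)
  fix m assume "m \<in> Poly_Mapping.keys p"
  with assms obtain h where h: "h \<in> Y" "0 < Poly_Mapping.lookup m h" by blast
  have "\<exists>r. m = Poly_Mapping.single h 1 + r"
    by (rule mon_divides_lookup) (use h in \<open>auto simp: lookup_single when_def\<close>)
  with h show "\<exists>b\<in>Y. \<exists>r. m = Poly_Mapping.single b 1 + r" by blast
qed simp

lemma keys_var_times:
  fixes p :: "('v::finite, 'k::field) mpoly"
  shows "m \<in> Poly_Mapping.keys (var h * p) \<Longrightarrow> 0 < Poly_Mapping.lookup m h"
  by (auto simp: var_def keys_single_times lookup_add)

lemma colon_vars:
  fixes p :: "('v::finite, 'k::field) mpoly"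
  assumes "h \<notin> Y" "var h * p = (\<Sum>s\<in>Y. var s * q s)"
  shows "\<exists>q'. p = (\<Sum>s\<in>Y. var s * q' s)"
proof (rule combination_of_vars)
  fix m assume "m \<in> Poly_Mapping.keys p"
  then have "Poly_Mapping.single h 1 + m \<in> Poly_Mapping.keys (var h * p)"
    by (auto simp: var_def keys_single_times)
  then obtain s where s: "s \<in> Y" "Poly_Mapping.single h 1 + m \<in> Poly_Mapping.keys (var s * q s)"
    unfolding assms(2) using subsetD[OF keys_sum] by fast
  have "s \<noteq> h" using s(1) assms(1) by auto
  with keys_var_times[OF s(2)] have "0 < Poly_Mapping.lookup m s"
    by (simp add: lookup_add lookup_single_not_eq)
  with s(1) show "\<exists>s\<in>Y. 0 < Poly_Mapping.lookup m s" by blast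
qed

text \<open>Induction on the set of variables. Let \<open>h\<close> be the last one, and split \<open>z\<close> into the part \<open>z1\<close>
avoiding \<open>h\<close> and the part \<open>z2\<close> containing it (with \<open>h\<close> removed). Then \<open>z2\<close> is a cycle for the other
variables and \<open>x\<^sub>h z2\<close> is, up to sign, the boundary of \<open>z1\<close>. Hence \<open>z2\<close> is a boundary: by
induction in positive degree, and in degree 0 because \<open>x\<^sub>h\<close> is a nonzerodivisor modulo the other
variables. Subtracting the corresponding boundary from \<open>z\<close> leaves a cycle in the other
variables.\<close>

lemma koszul_exact:
  fixes z :: "'v::finite set \<Rightarrow> ('v, 'k::field) mpoly"
  assumes "\<And>S. z S \<noteq> 0 \<Longrightarrow> S \<subseteq> Y \<and> card S = Suc i" and "\<And>T. koszul_diff z T = 0"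
  shows "\<exists>y. (\<forall>S. y S \<noteq> 0 \<longrightarrow> S \<subseteq> Y \<and> card S = Suc (Suc i)) \<and> (\<forall>T. koszul_diff y T = z T)"
  using assms
proof (induction "card Y" arbitrary: Y z i)
  case 0
  then have "Y = {}" by simp
  with 0 have "z S = 0" for S by force
  then show ?case by (intro exI[of _ "\<lambda>_. 0"]) (simp add: koszul_diff_def)
next
  case (Suc N)
  have "Y \<noteq> {}" using Suc.hyps(2) by auto
  then have "Max (to_nat ` Y) \<in> to_nat ` Y" by simp
  then obtain h where h: "h \<in> Y" "to_nat h = Max (to_nat ` Y)" by auto
  define X where "X = Y - {h}"
  have Y: "Y = insert h X" "h \<notin> X" using h(1) by (auto simp: X_def)
  have cX: "card X = N" using Suc.hyps(2) Y by simp
  have small: "to_nat s < to_nat h" if "s \<in> X" for s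
  proof -
    have "to_nat s \<le> to_nat h" using that h(2) by (simp add: X_def)
    moreover have "to_nat s \<noteq> to_nat h" using that Y(2) by auto
    ultimately show ?thesis by (rule le_neq_implies_less)
  qed
  have sign_ins: "koszul_sign s (insert h T) = (koszul_sign s T :: ('v, 'k) mpoly)" if "s \<in> X" "h \<notin> T" for s T
    using small[OF that(1)] that(2) by (simp add: koszul_sign_insert)
  have sign_h: "koszul_sign h T = ((- 1) ^ card T :: ('v, 'k) mpoly)" if "T \<subseteq> X" for T
  proof -
    have "{s \<in> T. to_nat s < to_nat h} = T" using small that by auto
    then show ?thesis by (simp add: koszul_sign_def)
  qed
  have split: "koszul_diff w T = koszul_diff (\<lambda>S. if h \<in> S then 0 else w S) T + koszul_sign h T * var h * w (insert h T)"
    if "h \<notin> T" for w :: "'v set \<Rightarrow> ('v, 'k) mpoly" and T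
  proof -
    have "-T = insert h (-T - {h})" using that by auto
    then have *: "(\<Sum>s\<in>-T. F s) = F h + (\<Sum>s\<in>-T - {h}. F s)" for F :: "'v \<Rightarrow> ('v, 'k) mpoly"
      by (metis Diff_iff finite_code insertI1 sum.insert singletonI)
    have "(\<Sum>s\<in>-T - {h}. koszul_sign s T * var s * w (insert s T)) =
       (\<Sum>s\<in>-T - {h}. koszul_sign s T * var s * (if h \<in> insert s T then 0 else w (insert s T)))"
      by (rule sum.cong) (use that in auto)
    then show ?thesis unfolding koszul_diff_def by (subst (1 2) *) (simp add: add.commute)
  qed
  have link: "koszul_diff w (insert h T) = koszul_diff (\<lambda>S. if h \<in> S then 0 else w (insert h S)) T"
    if "h \<notin> T" and w: "\<And>S. w S \<noteq> 0 \<Longrightarrow> S \<subseteq> Y" for w :: "'v set \<Rightarrow> ('v, 'k) mpoly" and T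
  proof -
    have "koszul_sign s (insert h T) * var s * w (insert s (insert h T))
        = koszul_sign s T * var s * (if h \<in> insert s T then 0 else w (insert h (insert s T)))"
      if s: "s \<in> - insert h T" for s
    proof (cases "w (insert s (insert h T)) = 0")
      case True
      then show ?thesis using s by (simp add: insert_commute)
    next
      case False
      with w have "s \<in> Y" by blast
      with s Y have "s \<in> X" by auto
      with sign_ins \<open>h \<notin> T\<close> s show ?thesis by (auto simp: insert_commute)
    qed
    then have "koszul_diff w (insert h T) =
      (\<Sum>s\<in>- insert h T. koszul_sign s T * var s * (if h \<in> insert s T then 0 else w (insert h (insert s T))))"
      unfolding koszul_diff_def by (rule sum.cong[OF refl])
    also have "\<dots> = koszul_diff (\<lambda>S. if h \<in> S then 0 else w (insert h S)) T"
      unfolding koszul_diff_def by (rule sum.mono_neutral_left) auto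
    finally show ?thesis .
  qed
  define z1 where "z1 S = (if h \<in> S then 0 else z S)" for S
  define z2 where "z2 S = (if h \<in> S then 0 else z (insert h S))" for S
  have z1_eq: "z1 = (\<lambda>S. if h \<in> S then 0 else z S)" and z2_eq: "z2 = (\<lambda>S. if h \<in> S then 0 else z (insert h S))"
    by (simp_all add: z1_def z2_def fun_eq_iff)
  have z1s: "S \<subseteq> X \<and> card S = Suc i" if "z1 S \<noteq> 0" for S
    using that Suc.prems(1)[of S] Y by (auto simp: z1_def split: if_splits)
  have z2s: "S \<subseteq> X \<and> card S = i" if "z2 S \<noteq> 0" for S
    using that Suc.prems(1)[of "insert h S"] Y by (auto simp: z2_def split: if_splits)
  have z2c: "koszul_diff z2 T = 0" for T
  proof (cases "h \<in> T")
    case True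
    then show ?thesis by (simp add: koszul_diff_def z2_def)
  next
    case False
    have "koszul_diff z (insert h T) = koszul_diff z2 T"
      unfolding z2_eq by (rule link[OF False]) (use Suc.prems(1) in blast)
    with Suc.prems(2)[of "insert h T"] show ?thesis by simp
  qed
  have z1c: "koszul_diff z1 T = - (koszul_sign h T * var h * z2 T)" if "h \<notin> T" for T
  proof -
    have "koszul_diff z1 T + koszul_sign h T * var h * z2 T = 0"
      using split[OF that, of z] Suc.prems(2)[of T] that unfolding z1_eq by (simp add: z2_def)
    then show ?thesis by (simp add: eq_neg_iff_add_eq_0)
  qed
  have "\<exists>y2. (\<forall>S. y2 S \<noteq> 0 \<longrightarrow> S \<subseteq> X \<and> card S = Suc i) \<and> (\<forall>T. koszul_diff y2 T = z2 T)"
  proof (cases i)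
    case (Suc j)
    then show ?thesis using Suc.hyps(1)[OF cX[symmetric], of z2 j] z2s z2c by auto
  next
    case 0
    have "koszul_diff z1 {} = (\<Sum>s\<in>X. var s * z1 {s})"
      unfolding koszul_diff_def by (rule sum.mono_neutral_cong_right) (use z1s in force)+
    then have "var h * z2 {} = - (\<Sum>s\<in>X. var s * z1 {s})"
      using z1c[of "{}"] by (metis empty_iff koszul_sign_empty minus_minus mult_1)
    then have "var h * z2 {} = (\<Sum>s\<in>X. var s * (- z1 {s}))"
      by (simp add: sum_negf)
    from colon_vars[OF Y(2) this] obtain q where q: "z2 {} = (\<Sum>s\<in>X. var s * q s)" ..
    define y2 where "y2 S = (if \<exists>s\<in>X. S = {s} then q (the_elem S) else 0)" for S
    have y2s: "S \<subseteq> X \<and> card S = Suc i" if "y2 S \<noteq> 0" for S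
      using that 0 by (auto simp: y2_def split: if_splits)
    have "koszul_diff y2 T = z2 T" for T
    proof (cases "T = {}")
      case True
      have "koszul_diff y2 {} = (\<Sum>s\<in>X. var s * q s)"
        unfolding koszul_diff_def by (rule sum.mono_neutral_cong_right) (auto simp: y2_def)
      with q True show ?thesis by simp
    next
      case False
      have "y2 (insert s T) = 0" if "s \<notin> T" for s
      proof (rule ccontr)
        assume "y2 (insert s T) \<noteq> 0"
        with y2s 0 have "card (insert s T) = 1" by force
        with that False show False by simp
      qed
      moreover have "z2 T = 0" using z2s[of T] 0 False by auto
      ultimately show ?thesis by (simp add: koszul_diff_def)
    qed
    with y2s show ?thesis by blast
  qed
  then obtain y2 where y2s: "\<And>S. y2 S \<noteq> 0 \<Longrightarrow> S \<subseteq> X \<and> card S = Suc i" and y2c: "\<And>T. koszul_diff y2 T = z2 T"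
    by blast
  define w where "w S = z1 S + (- 1) ^ i * var h * y2 S" for S
  have ws: "S \<subseteq> X \<and> card S = Suc i" if "w S \<noteq> 0" for S
    using that z1s[of S] y2s[of S] by (cases "z1 S = 0"; cases "y2 S = 0") (auto simp: w_def)
  have wc: "koszul_diff w T = 0" for T
  proof (cases "h \<in> T")
    case True
    then have "w (insert s T) = 0" for s using ws[of "insert s T"] Y(2) by auto
    then show ?thesis by (simp add: koszul_diff_def)
  next
    case False
    have "koszul_diff w T = koszul_diff z1 T + (- 1) ^ i * var h * koszul_diff y2 T"
      unfolding koszul_diff_def w_def by (simp add: algebra_simps sum.distrib sum_distrib_left)
    also have "\<dots> = ((- 1) ^ i - koszul_sign h T) * var h * z2 T"
      using z1c[OF False] y2c[of T] by (simp add: algebra_simps)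
    also have "\<dots> = 0"
      using z2s[of T] sign_h[of T] by (cases "z2 T = 0") auto
    finally show ?thesis .
  qed
  obtain y1 where y1s: "\<And>S. y1 S \<noteq> 0 \<Longrightarrow> S \<subseteq> X \<and> card S = Suc (Suc i)" and y1c: "\<And>T. koszul_diff y1 T = w T"
    using Suc.hyps(1)[OF cX[symmetric], of w i] ws wc by blast
  define y where "y S = (if h \<in> S then y2 (S - {h}) else y1 S)" for S
  have ys: "S \<subseteq> Y \<and> card S = Suc (Suc i)" if "y S \<noteq> 0" for S
  proof (cases "h \<in> S")
    case True
    with that y2s[of "S - {h}"] have "S - {h} \<subseteq> X" "card (S - {h}) = Suc i" by (auto simp: y_def)
    with True Y show ?thesis by (auto simp: card_Diff_singleton_if)
  next
    case False
    with that y1s[of S] Y show ?thesis by (auto simp: y_def)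
  qed
  have y1_eq: "(\<lambda>S. if h \<in> S then 0 else y S) = y1"
    using y1s Y(2) by (fastforce simp: y_def)
  have y2_eq: "(\<lambda>S. if h \<in> S then 0 else y (insert h S)) = y2"
    using y2s Y(2) by (fastforce simp: y_def)
  have "koszul_diff y T = z T" for T
  proof (cases "h \<in> T")
    case True
    define T' where "T' = T - {h}"
    have T': "T = insert h T'" "h \<notin> T'" using True by (auto simp: T'_def)
    have "koszul_diff y T = z2 T'"
      unfolding T'(1) using link[OF T'(2), of y] ys y2c by (simp add: y2_eq)
    with T' show ?thesis by (simp add: z2_def)
  next
    case False
    have "koszul_diff y T = koszul_diff y1 T + koszul_sign h T * var h * y2 T"
      using split[OF False, of y] False by (simp add: y1_eq) (simp add: y_def)
    also have "\<dots> = z1 T + ((- 1) ^ i + koszul_sign h T) * var h * y2 T"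
      by (simp add: y1c w_def algebra_simps)
    also have "\<dots> = z1 T"
      using y2s[of T] sign_h[of T] by (cases "y2 T = 0") auto
    finally show ?thesis using False by (simp add: z1_def)
  qed
  with ys show ?case by blast
qed

section \<open>Twisted Koszul complexes over a down-closed set\<close>

abbreviation inc :: "'v \<Rightarrow> ('v \<Rightarrow> nat) \<Rightarrow> 'v \<Rightarrow> nat" where
  "inc h b \<equiv> b(h := Suc (b h))"

text \<open>Chains are given by their coefficients at the basis elements \<open>(b, S)\<close>. All complexes
below are formed by chains supported on a finite set of basis elements.\<close>

type_synonym ('v, 'k) chain = "('v \<Rightarrow> nat) \<times> 'v set \<Rightarrow> ('v, 'k) mpoly"

text \<open>The differential that sends a basis element \<open>(b, S)\<close> to the signed sum over \<open>h \<in> S\<close> of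
\<open>x\<^sub>h (b, S - {h}) - c\<^sub>h (b - e\<^sub>h, S - {h})\<close>, written out in terms of coefficients: the coefficient at
\<open>(b, T)\<close> collects contributions from \<open>(b, insert h T)\<close> and from \<open>(b + e\<^sub>h, insert h T)\<close>. Reading it
this way avoids subtraction on exponents.\<close>

definition twisted_diff :: "('v::finite \<Rightarrow> ('v, 'k::field) mpoly) \<Rightarrow> ('v, 'k) chain \<Rightarrow> ('v, 'k) chain" where
  "twisted_diff c z = (\<lambda>(b, T). \<Sum>h\<in>-T. koszul_sign h T *
     (var h * z (b, insert h T) - c h * z (inc h b, insert h T)))"

lemma twisted_diff_add: "twisted_diff c (\<lambda>\<beta>. y \<beta> + z \<beta>) = (\<lambda>\<beta>. twisted_diff c y \<beta> + twisted_diff c z \<beta>)"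
  by (auto simp: twisted_diff_def fun_eq_iff algebra_simps sum.distrib sum_subtractf)

lemma twisted_diff_minus: "twisted_diff c (\<lambda>\<beta>. y \<beta> - z \<beta>) = (\<lambda>\<beta>. twisted_diff c y \<beta> - twisted_diff c z \<beta>)"
  by (auto simp: twisted_diff_def fun_eq_iff algebra_simps sum.distrib sum_subtractf)

lemma twisted_diff_scale: "twisted_diff c (\<lambda>\<beta>. r * z \<beta>) = (\<lambda>\<beta>. r * twisted_diff c z \<beta>)"
  by (auto simp: twisted_diff_def fun_eq_iff algebra_simps sum_distrib_left)

lemma twisted_diff_zero [simp]: "twisted_diff c (\<lambda>\<beta>. 0) = (\<lambda>\<beta>. 0)"
  by (auto simp: twisted_diff_def)

lemma twisted_diff_sum:
  "twisted_diff c (\<lambda>\<beta>. \<Sum>i\<in>I. z i \<beta>) = (\<lambda>\<beta>. \<Sum>i\<in>I. twisted_diff c (z i) \<beta>)"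
  by (induction I rule: infinite_finite_induct) (simp_all add: twisted_diff_add)

lemma antisymmetric_sum_zero:
  fixes F :: "'a \<Rightarrow> 'a \<Rightarrow> 'r::ab_group_add"
  assumes "finite A" "\<And>g h. g \<in> A \<Longrightarrow> h \<in> A \<Longrightarrow> g \<noteq> h \<Longrightarrow> F g h = - F h g"
  shows "(\<Sum>h\<in>A. \<Sum>g\<in>A - {h}. F h g) = 0"
  using assms
proof (induction A rule: finite_induct)
  case (insert a A)
  have "(\<Sum>g\<in>insert a A - {h}. F h g) = F h a + (\<Sum>g\<in>A - {h}. F h g)" if "h \<in> A" for h
  proof -
    have "insert a A - {h} = insert a (A - {h})" using that insert.hyps by auto
    then show ?thesis using insert.hyps by simp
  qed
  moreover have "insert a A - {a} = A" using insert.hyps by auto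
  ultimately have "(\<Sum>h\<in>insert a A. \<Sum>g\<in>insert a A - {h}. F h g)
      = (\<Sum>g\<in>A. F a g) + ((\<Sum>h\<in>A. F h a) + (\<Sum>h\<in>A. \<Sum>g\<in>A - {h}. F h g))"
    using insert.hyps by (simp add: sum.distrib)
  also have "(\<Sum>h\<in>A. \<Sum>g\<in>A - {h}. F h g) = 0"
    by (rule insert.IH) (rule insert.prems; simp)
  also have "(\<Sum>g\<in>A. F a g) + ((\<Sum>h\<in>A. F h a) + 0) = (\<Sum>g\<in>A. F a g + F g a)"
    by (simp add: sum.distrib)
  also have "\<dots> = 0"
  proof (rule sum.neutral, rule ballI)
    fix g assume "g \<in> A"
    with insert.hyps have "F a g = - F g a" by (intro insert.prems) auto
    then show "F a g + F g a = 0" by simp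
  qed
  finally show ?case .
qed simp

text \<open>The operators \<open>x\<^sub>h - c\<^sub>h\<close>(shift by \<open>e\<^sub>h\<close>) commute with each other, so the signs of the Koszul
complex make the double sum antisymmetric.\<close>

lemma twisted_diff_twisted_diff: "twisted_diff c (twisted_diff c z) = (\<lambda>\<beta>. 0)"
proof (rule ext, clarify)
  fix b T
  define A where "A h g = var h * (var g * z (b, insert g (insert h T))) - var h * (c g * z (inc g b, insert g (insert h T)))
      - c h * (var g * z (inc h b, insert g (insert h T))) + c h * (c g * z (inc g (inc h b), insert g (insert h T)))" for h g
  have Asym: "A h g = A g h" if "h \<noteq> g" for h g
    using that by (simp add: A_def insert_commute fun_upd_twist algebra_simps)
  have comp: "- insert h T = - T - {h}" for h by auto
  have pull: "s * (x * sum F G - y * sum F' G) = (\<Sum>g\<in>G. s * (x * F g - y * F' g))"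
    for s x y :: "('a, 'b) mpoly" and F F' and G :: "'a set"
    by (simp add: sum_distrib_left sum_subtractf right_diff_distrib)
  have "twisted_diff c (twisted_diff c z) (b, T)
      = (\<Sum>h\<in>-T. \<Sum>g\<in>-T - {h}. koszul_sign h T * koszul_sign g (insert h T) * A h g)"
    unfolding twisted_diff_def A_def comp prod.case pull
    by (intro sum.cong refl) (simp add: algebra_simps)
  also have "\<dots> = 0"
  proof (rule antisymmetric_sum_zero)
    fix g h assume gh: "g \<in> -T" "h \<in> -T" "g \<noteq> h"
    then have "koszul_sign g T * koszul_sign h (insert g T) = (- (koszul_sign h T * koszul_sign g (insert h T)) :: ('a, 'b) mpoly)"
      by (intro koszul_sign_swap) auto
    with Asym[OF gh(3)] show "koszul_sign g T * koszul_sign h (insert g T) * A g h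
        = - (koszul_sign h T * koszul_sign g (insert h T) * A h g)" by simp
  qed simp
  finally show "twisted_diff c (twisted_diff c z) (b, T) = 0" .
qed

locale down_closed =
  fixes D :: "('v::finite \<Rightarrow> nat) set"
  assumes finite_D: "finite D"
    and down: "\<And>b b'. b \<in> D \<Longrightarrow> (\<And>v. b' v \<le> b v) \<Longrightarrow> b' \<in> D"
begin

text \<open>The condition that \<open>S\<close> is contained in the support of \<open>b\<close> makes \<open>b - e\<^sub>h\<close> meaningful for \<open>h \<in> S\<close>;
the element \<open>b - e\<^sub>h\<close> stays in \<open>D\<close> since \<open>D\<close> is closed downwards.\<close>

definition basis :: "nat \<Rightarrow> (('v \<Rightarrow> nat) \<times> 'v set) set" where
  "basis i = {(b, S). b \<in> D \<and> (\<forall>h\<in>S. 0 < b h) \<and> card S = i}"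

definition chains :: "nat \<Rightarrow> ('v, 'k::field) chain set" where
  "chains i = {z. \<forall>\<beta>. z \<beta> \<noteq> 0 \<longrightarrow> \<beta> \<in> basis i}"

lemma finite_basis: "finite (basis i)"
  by (rule finite_subset[of _ "D \<times> UNIV"]) (auto simp: basis_def finite_D)

lemma chains_zero_outside: "z \<in> chains i \<Longrightarrow> \<beta> \<notin> basis i \<Longrightarrow> z \<beta> = 0"
  unfolding chains_def by blast

lemma chains_add: "y \<in> chains i \<Longrightarrow> z \<in> chains i \<Longrightarrow> (\<lambda>\<beta>. y \<beta> + z \<beta>) \<in> chains i"
  by (force simp: chains_def)

lemma chains_minus: "y \<in> chains i \<Longrightarrow> z \<in> chains i \<Longrightarrow> (\<lambda>\<beta>. y \<beta> - z \<beta>) \<in> chains i"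
  by (force simp: chains_def)

lemma twisted_diff_chains:
  assumes z: "z \<in> chains (Suc i)"
  shows "twisted_diff c z \<in> chains i"
proof -
  have "(b, T) \<in> basis i" if "twisted_diff c z (b, T) \<noteq> 0" for b T
  proof -
    have "\<exists>h\<in>-T. koszul_sign h T * (var h * z (b, insert h T) - c h * z (inc h b, insert h T)) \<noteq> 0"
      using that unfolding twisted_diff_def prod.case by (meson sum.neutral)
    then obtain h where "h \<notin> T"
      "koszul_sign h T * (var h * z (b, insert h T) - c h * z (inc h b, insert h T)) \<noteq> 0" by auto
    then have h: "h \<notin> T" "z (b, insert h T) \<noteq> 0 \<or> z (inc h b, insert h T) \<noteq> 0"
      by auto
    with z consider "(b, insert h T) \<in> basis (Suc i)" | "(inc h b, insert h T) \<in> basis (Suc i)"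
      by (auto simp: chains_def)
    then show ?thesis
    proof cases
      case 1
      with h(1) show ?thesis by (auto simp: basis_def)
    next
      case 2
      then have "b \<in> D" using down[of "inc h b" b] by (auto simp: basis_def)
      moreover have "0 < b g" if "g \<in> T" for g
        using 2 h(1) that by (auto simp: basis_def split: if_splits)
      ultimately show ?thesis using 2 h(1) by (simp add: basis_def)
    qed
  qed
  then show ?thesis by (auto simp: chains_def)
qed

lemma total_bounded: "\<exists>N. \<forall>b\<in>D. sum b UNIV < N"
  using finite_nat_set_iff_bounded[of "(\<lambda>b. sum b UNIV) ` D"] finite_D by auto

lemma sum_inc: "sum (inc h b) UNIV = Suc (sum b UNIV)" for h :: 'v
proof -
  have "sum (inc h b) UNIV = inc h b h + sum (inc h b) (UNIV - {h})"
    by (subst sum.remove[of _ h]) auto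
  also have "sum (inc h b) (UNIV - {h}) = sum b (UNIV - {h})"
    by (rule sum.cong) auto
  finally show ?thesis by (subst (2) sum.remove[of _ h]) auto
qed

text \<open>The twisting terms lower the total of \<open>b\<close>, so on the largest total occurring in a chain only the
Koszul differential is visible.\<close>

lemma twisted_diff_top:
  fixes z :: "('v, 'k::field) chain"
  assumes "\<And>b S. z (b, S) \<noteq> 0 \<Longrightarrow> sum b UNIV < Suc N" and "N \<le> sum b UNIV"
  shows "twisted_diff c z (b, T) = koszul_diff (\<lambda>S. z (b, S)) T"
proof -
  have "z (inc h b, S) = 0" for h S
    using assms sum_inc[of b h] by (metis Suc_le_mono not_less)
  then show ?thesis by (simp add: twisted_diff_def koszul_diff_def mult.assoc)
qed

text \<open>A cycle restricts on its largest total \<open>N\<close> to Koszul cycles on the variables of the support of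
each \<open>b\<close>. Lifting these and subtracting the boundary leaves a cycle with totals below \<open>N\<close>. The
coefficients \<open>c\<close> are arbitrary so that the result applies both to a resolution and to its linear
part.\<close>

lemma twisted_diff_exact:
  fixes z :: "('v, 'k::field) chain"
  assumes "z \<in> chains (Suc i)" and "twisted_diff c z = (\<lambda>\<beta>. 0)"
  shows "\<exists>y\<in>chains (Suc (Suc i)). twisted_diff c y = z"
proof -
  have *: "\<exists>y\<in>chains (Suc (Suc i)). twisted_diff c y = z"
    if "z \<in> chains (Suc i)" "twisted_diff c z = (\<lambda>\<beta>. 0)" "\<And>b S. z (b, S) \<noteq> 0 \<Longrightarrow> sum b UNIV < N" for N and z :: "('v, 'k) chain"
    using that
  proof (induction N arbitrary: z)
    case 0
    then have "z = (\<lambda>\<beta>. 0)" by (force simp: fun_eq_iff)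
    then show ?case by (intro bexI[of _ "\<lambda>\<beta>. 0"]) (auto simp: chains_def)
  next
    case (Suc N)
    have "\<exists>y. (\<forall>S. y S \<noteq> 0 \<longrightarrow> S \<subseteq> {h. 0 < b h} \<and> card S = Suc (Suc i)) \<and> (\<forall>T. koszul_diff y T = z (b, T))"
      if b: "sum b UNIV = N" for b
    proof (rule koszul_exact)
      show "S \<subseteq> {h. 0 < b h} \<and> card S = Suc i" if "z (b, S) \<noteq> 0" for S
        using that Suc.prems(1) by (auto simp: chains_def basis_def)
      show "koszul_diff (\<lambda>S. z (b, S)) T = 0" for T
        using twisted_diff_top[of z N b c T] Suc.prems(2,3) b by simp
    qed
    then obtain Y where Y: "\<And>b S. sum b UNIV = N \<Longrightarrow> Y b S \<noteq> 0 \<Longrightarrow> S \<subseteq> {h. 0 < b h} \<and> card S = Suc (Suc i)"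
      "\<And>b T. sum b UNIV = N \<Longrightarrow> koszul_diff (Y b) T = z (b, T)"
      by metis
    define y0 where "y0 = (\<lambda>(b, S). if sum b UNIV = N \<and> b \<in> D then Y b S else 0)"
    have y0: "y0 \<in> chains (Suc (Suc i))"
      using Y(1) by (force simp: chains_def basis_def y0_def split: if_splits)
    have y0N: "sum b UNIV < Suc N" if "y0 (b, S) \<noteq> 0" for b S
      using that by (auto simp: y0_def split: if_splits)
    define z1 where "z1 \<beta> = z \<beta> - twisted_diff c y0 \<beta>" for \<beta>
    have z1: "z1 \<in> chains (Suc i)"
      unfolding z1_def by (intro chains_minus twisted_diff_chains y0 Suc.prems)
    have "twisted_diff c z1 = (\<lambda>\<beta>. 0)"
      unfolding z1_def twisted_diff_minus twisted_diff_twisted_diff using Suc.prems(2) by simp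
    moreover have "sum b UNIV < N" if "z1 (b, S) \<noteq> 0" for b S
    proof (rule ccontr)
      assume "\<not> sum b UNIV < N"
      then have N: "N \<le> sum b UNIV" by simp
      have bD: "b \<in> D" using that z1 by (auto simp: chains_def basis_def)
      have td: "twisted_diff c y0 (b, S) = koszul_diff (\<lambda>S. y0 (b, S)) S"
        by (rule twisted_diff_top[OF y0N N])
      show False
      proof (cases "sum b UNIV = N")
        case True
        with bD have "(\<lambda>S. y0 (b, S)) = Y b" by (simp add: y0_def)
        with td True Y(2) that show False by (simp add: z1_def)
      next
        case False
        with td have "twisted_diff c y0 (b, S) = 0" by (simp add: y0_def koszul_diff_def)
        with that have "z (b, S) \<noteq> 0" by (simp add: z1_def)
        with Suc.prems(3) N False show False by fastforce
      qed
    qed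
    ultimately obtain y1 where y1: "y1 \<in> chains (Suc (Suc i))" "twisted_diff c y1 = z1"
      using Suc.IH[of z1] z1 by blast
    have "twisted_diff c (\<lambda>\<beta>. y0 \<beta> + y1 \<beta>) = z"
      unfolding twisted_diff_add y1(2) by (simp add: z1_def)
    with chains_add[OF y0 y1(1)] show ?case by blast
  qed
  obtain N where N: "\<forall>b\<in>D. sum b UNIV < N" using total_bounded by blast
  have "sum b UNIV < N" if "z (b, S) \<noteq> 0" for b S
    using that N assms(1) by (auto simp: chains_def basis_def)
  with assms show ?thesis by (rule *)
qed

end

section \<open>The augmentation onto a deficit ideal\<close>

text \<open>\<open>X\<close> is the vertex set of the original graph, its complement consists of the pendants, and \<open>f\<close> sends
a pendant to its neighbour.\<close>

locale pendant_deficits = down_closed D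
  for D :: "('v::finite \<Rightarrow> nat) set" +
  fixes X :: "'v set" and f :: "'v \<Rightarrow> 'v" and n :: nat
  assumes f_onto: "f ` (- X) = X"
    and bound: "b \<in> D \<Longrightarrow> b v \<le> n"
    and off: "b \<in> D \<Longrightarrow> v \<notin> X \<Longrightarrow> b v = 0"
begin

text \<open>The exponent of \<open>u\<^sub>b = \<Prod>\<^sub>h x\<^sub>h\<^bsup>n - b\<^sub>h\<^esup> y\<^sub>h\<^bsup>b\<^sub>h\<^esup>\<close>, where \<open>y\<^sub>h\<close> is the product of the pendants at
\<open>h\<close>.\<close>

definition gen_exp :: "('v \<Rightarrow> nat) \<Rightarrow> ('v \<Rightarrow>\<^sub>0 nat)" where
  "gen_exp b = Abs_poly_mapping (\<lambda>v. if v \<in> X then n - b v else b (f v))"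

definition pendant_exp :: "'v \<Rightarrow> ('v \<Rightarrow>\<^sub>0 nat)" where
  "pendant_exp h = Abs_poly_mapping (\<lambda>v. if v \<notin> X \<and> f v = h then 1 else 0)"

lemma lookup_gen_exp: "Poly_Mapping.lookup (gen_exp b) v = (if v \<in> X then n - b v else b (f v))"
  by (simp add: gen_exp_def)

lemma lookup_pendant_exp: "Poly_Mapping.lookup (pendant_exp h) v = (if v \<notin> X \<and> f v = h then 1 else 0)"
  by (simp add: pendant_exp_def)

text \<open>The relation \<open>y\<^sub>h u\<^sub>b = x\<^sub>h u\<^bsub>b + e\<^sub>h\<^esub>\<close>, which is the source of the twist in the differential.\<close>

lemma gen_exp_inc:
  assumes "inc h b \<in> D"
  shows "gen_exp b + pendant_exp h = gen_exp (inc h b) + Poly_Mapping.single h 1"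
proof (rule poly_mapping_eqI)
  fix v
  have "h \<in> X" using off[OF assms, of h] by auto
  moreover have "Suc (b h) \<le> n" using bound[OF assms, of h] by simp
  ultimately show "Poly_Mapping.lookup (gen_exp b + pendant_exp h) v
      = Poly_Mapping.lookup (gen_exp (inc h b) + Poly_Mapping.single h 1) v"
    by (auto simp: lookup_add lookup_gen_exp lookup_pendant_exp lookup_single when_def)
qed

definition pendant_prod :: "'v \<Rightarrow> ('v, 'k::field) mpoly" where
  "pendant_prod h = mon (pendant_exp h)"

definition augment :: "('v, 'k::field) chain \<Rightarrow> ('v, 'k) mpoly" where
  "augment z = (\<Sum>b\<in>D. mon (gen_exp b) * z (b, {}))"

lemma augment_minus: "augment (\<lambda>\<beta>. y \<beta> - z \<beta>) = augment y - augment z"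
  by (simp add: augment_def right_diff_distrib sum_subtractf)

text \<open>In the double sum the contribution of \<open>x\<^sub>h u\<^bsub>b + e\<^sub>h\<^esub>\<close> cancels against that of \<open>y\<^sub>h u\<^sub>b\<close>.\<close>

lemma augment_twisted_diff:
  fixes z :: "('v, 'k::field) chain"
  assumes z: "z \<in> chains (Suc 0)"
  shows "augment (twisted_diff pendant_prod z) = 0"
proof -
  have "(\<Sum>b\<in>D. mon (gen_exp b) * (var h * z (b, {h})))
      = (\<Sum>b\<in>D. mon (gen_exp b) * (pendant_prod h * z (inc h b, {h})))" for h
  proof -
    have "(\<Sum>b\<in>D. mon (gen_exp b) * (var h * z (b, {h})))
        = (\<Sum>b\<in>{b\<in>D. 0 < b h}. mon (gen_exp b) * (var h * z (b, {h})))"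
    proof (rule sum.mono_neutral_right[OF finite_D], blast, rule ballI)
      fix b assume "b \<in> D - {b \<in> D. 0 < b h}"
      then have "(b, {h}) \<notin> basis (Suc 0)" by (auto simp: basis_def)
      with z have "z (b, {h}) = 0" by (rule chains_zero_outside)
      then show "mon (gen_exp b) * (var h * z (b, {h})) = 0" by simp
    qed
    also have "\<dots> = (\<Sum>b\<in>{b\<in>D. inc h b \<in> D}. mon (gen_exp b) * (pendant_prod h * z (inc h b, {h})))"
    proof (rule sum.reindex_bij_witness[of _ "\<lambda>b. inc h b" "\<lambda>b. b(h := b h - 1)"])
      fix b assume b: "b \<in> {b \<in> D. 0 < b h}"
      then show *: "inc h (b(h := b h - 1)) = b" by auto
      from b show "b(h := b h - 1) \<in> {b \<in> D. inc h b \<in> D}"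
        using down[of b "b(h := b h - 1)"] * by auto
      have "mon (gen_exp (b(h := b h - 1))) * pendant_prod h = (mon (gen_exp b) * var h :: ('v, 'k) mpoly)"
        using gen_exp_inc[of "b(h := b h - 1)" h] b
        unfolding * pendant_prod_def var_def mult_single by simp
      then show "mon (gen_exp (b(h := b h - 1))) * (pendant_prod h * z (inc h (b(h := b h - 1)), {h}))
          = mon (gen_exp b) * (var h * z (b, {h}))"
        unfolding * by (simp add: mult.assoc[symmetric])
    qed auto
    also have "\<dots> = (\<Sum>b\<in>D. mon (gen_exp b) * (pendant_prod h * z (inc h b, {h})))"
    proof (rule sum.mono_neutral_left[OF finite_D], blast, rule ballI)
      fix b assume "b \<in> D - {b \<in> D. inc h b \<in> D}"
      then have "(inc h b, {h}) \<notin> basis (Suc 0)" by (auto simp: basis_def)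
      with z have "z (inc h b, {h}) = 0" by (rule chains_zero_outside)
      then show "mon (gen_exp b) * (pendant_prod h * z (inc h b, {h})) = 0" by simp
    qed
    finally show ?thesis .
  qed
  then have "(\<Sum>h\<in>UNIV. \<Sum>b\<in>D. mon (gen_exp b) * (var h * z (b, {h}) - pendant_prod h * z (inc h b, {h}))) = 0"
    by (simp add: right_diff_distrib sum_subtractf)
  then show ?thesis
    unfolding augment_def twisted_diff_def by (subst (asm) sum.swap) (simp add: sum_distrib_left)
qed

text \<open>Since \<open>b'\<close> has no larger total than \<open>b\<close> and differs from it, \<open>b'\<^sub>h < b\<^sub>h\<close> for some \<open>h\<close>. Then the exponent
\<open>n - b'\<^sub>h\<close> of \<open>x\<^sub>h\<close> in \<open>u\<^bsub>b'\<^esub>\<close> exceeds the one in \<open>u\<^sub>b\<close>, so \<open>m\<close> must supply a factor \<open>x\<^sub>h\<close>.\<close>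

lemma gen_exp_linear_quotient:
  assumes b: "b \<in> D" "b' \<in> D" "b' \<noteq> b" "sum b' UNIV \<le> sum b UNIV"
    and eq: "gen_exp b + m = gen_exp b' + r"
  shows "\<exists>h\<in>{h. 0 < b h}. 0 < Poly_Mapping.lookup m h"
proof -
  have "\<exists>h. b' h < b h"
  proof (rule ccontr)
    assume "\<not> ?thesis"
    then have le: "b h \<le> b' h" for h by (simp add: not_less)
    have "b h = b' h" for h
    proof (rule ccontr)
      assume "b h \<noteq> b' h"
      with le[of h] have "b h < b' h" by simp
      with le have "sum b UNIV < sum b' UNIV" by (intro sum_strict_mono_ex1) auto
      with b(4) show False by simp
    qed
    with b(3) show False by auto
  qed
  then obtain h where h: "b' h < b h" by blast
  with off[OF b(1), of h] have "h \<in> X" by auto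
  have "Poly_Mapping.lookup (gen_exp b + m) h = Poly_Mapping.lookup (gen_exp b' + r) h" by (simp add: eq)
  then have "n - b h + Poly_Mapping.lookup m h = n - b' h + Poly_Mapping.lookup r h"
    using \<open>h \<in> X\<close> by (simp add: lookup_add lookup_gen_exp)
  with h bound[OF b(1), of h] have "0 < Poly_Mapping.lookup m h" by linarith
  with h show ?thesis by (intro bexI[of _ h]) auto
qed

text \<open>The strategy of \<open>twisted_diff_exact\<close>, with linear quotients in place of Koszul exactness: at each
\<open>b\<close> of the largest total, the coefficient lies in the ideal of the \<open>x\<^sub>h\<close> with \<open>b\<^sub>h > 0\<close>, and is
removed by a chain supported on the elements \<open>(b, {h})\<close>.\<close>

lemma augment_exact:
  fixes z :: "('v, 'k::field) chain"
  assumes "z \<in> chains 0" and "augment z = 0"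
  shows "\<exists>y\<in>chains (Suc 0). twisted_diff pendant_prod y = z"
proof -
  have *: "\<exists>y\<in>chains (Suc 0). twisted_diff pendant_prod y = z"
    if "z \<in> chains 0" "augment z = 0" "\<And>b S. z (b, S) \<noteq> 0 \<Longrightarrow> sum b UNIV < N" for N and z :: "('v, 'k) chain"
    using that
  proof (induction N arbitrary: z)
    case 0
    then have "z = (\<lambda>\<beta>. 0)" by (force simp: fun_eq_iff)
    then show ?case by (intro bexI[of _ "\<lambda>\<beta>. 0"]) (auto simp: chains_def)
  next
    case (Suc N)
    have "\<exists>q. z (b, {}) = (\<Sum>h | 0 < b h. var h * q h)" if b: "b \<in> D" "sum b UNIV = N" for b
    proof (rule combination_of_vars)
      fix m assume "m \<in> Poly_Mapping.keys (z (b, {}))"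
      then have m: "gen_exp b + m \<in> Poly_Mapping.keys (mon (gen_exp b) * z (b, {}))"
        by (simp add: keys_single_times)
      have "mon (gen_exp b) * z (b, {}) = - (\<Sum>b'\<in>D - {b}. mon (gen_exp b') * z (b', {}))"
        using Suc.prems(2) unfolding augment_def sum.remove[OF finite_D b(1)] by (simp add: eq_neg_iff_add_eq_0)
      with m have "gen_exp b + m \<in> Poly_Mapping.keys (\<Sum>b'\<in>D - {b}. mon (gen_exp b') * z (b', {}))"
        by (simp add: in_keys_iff)
      then obtain b' where b': "b' \<in> D - {b}" "gen_exp b + m \<in> Poly_Mapping.keys (mon (gen_exp b') * z (b', {}))"
        using subsetD[OF keys_sum] by fast
      then obtain r where r: "gen_exp b + m = gen_exp b' + r" by (auto simp: keys_single_times)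
      have "z (b', {}) \<noteq> 0" using b'(2) by auto
      then have "sum b' UNIV \<le> sum b UNIV" using Suc.prems(3) b(2) by fastforce
      then show "\<exists>h\<in>{h. 0 < b h}. 0 < Poly_Mapping.lookup m h"
        using gen_exp_linear_quotient[OF b(1) _ _ _ r] b'(1) by blast
    qed
    then obtain Q where Q: "\<And>b. b \<in> D \<Longrightarrow> sum b UNIV = N \<Longrightarrow> z (b, {}) = (\<Sum>h | 0 < b h. var h * Q b h)"
      by metis
    define y0 where "y0 = (\<lambda>(b, S). if b \<in> D \<and> sum b UNIV = N \<and> (\<exists>h. 0 < b h \<and> S = {h}) then Q b (the_elem S) else 0)"
    have y0: "y0 \<in> chains (Suc 0)"
      by (auto simp: chains_def basis_def y0_def split: if_splits)
    have y0N: "sum b UNIV < Suc N" if "y0 (b, S) \<noteq> 0" for b S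
      using that by (auto simp: y0_def split: if_splits)
    define z1 where "z1 \<beta> = z \<beta> - twisted_diff pendant_prod y0 \<beta>" for \<beta>
    have z1: "z1 \<in> chains 0"
      unfolding z1_def by (intro chains_minus twisted_diff_chains y0 Suc.prems)
    have "augment z1 = 0"
      unfolding z1_def augment_minus augment_twisted_diff[OF y0] using Suc.prems(2) by simp
    moreover have "sum b UNIV < N" if nz: "z1 (b, S) \<noteq> 0" for b S
    proof (rule ccontr)
      assume "\<not> sum b UNIV < N"
      then have N: "N \<le> sum b UNIV" by simp
      have bD: "b \<in> D" "S = {}" using nz z1 by (auto simp: chains_def basis_def)
      have "twisted_diff pendant_prod y0 (b, {}) = koszul_diff (\<lambda>S. y0 (b, S)) {}"
        by (rule twisted_diff_top[OF y0N N])
      then have td: "twisted_diff pendant_prod y0 (b, {}) = (\<Sum>h\<in>UNIV. var h * y0 (b, {h}))"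
        by (simp add: koszul_diff_def)
      show False
      proof (cases "sum b UNIV = N")
        case True
        have "(\<Sum>h\<in>UNIV. var h * y0 (b, {h})) = (\<Sum>h | 0 < b h. var h * Q b h)"
          by (rule sum.mono_neutral_cong_right) (use True bD in \<open>auto simp: y0_def\<close>)
        with td Q[OF bD(1) True] nz bD show False by (simp add: z1_def)
      next
        case False
        with td have "twisted_diff pendant_prod y0 (b, {}) = 0" by (simp add: y0_def)
        with nz bD have "z (b, S) \<noteq> 0" by (simp add: z1_def)
        with Suc.prems(3) N False show False by fastforce
      qed
    qed
    ultimately obtain y1 where y1: "y1 \<in> chains (Suc 0)" "twisted_diff pendant_prod y1 = z1"
      using Suc.IH[of z1] z1 by blast
    have "twisted_diff pendant_prod (\<lambda>\<beta>. y0 \<beta> + y1 \<beta>) = z"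
      unfolding twisted_diff_add y1(2) by (simp add: z1_def)
    with chains_add[OF y0 y1(1)] show ?case by blast
  qed
  obtain N where N: "\<forall>b\<in>D. sum b UNIV < N" using total_bounded by blast
  have "sum b UNIV < N" if "z (b, S) \<noteq> 0" for b S
    using that N assms(1) by (auto simp: chains_def basis_def)
  with assms show ?thesis by (rule *)
qed

lemma augment_image:
  "augment ` (chains 0 :: ('v, 'k::field) chain set)
    = mono_ideal {m. \<exists>b\<in>D. \<exists>r. m = gen_exp b + r}" (is "_ = ?I")
proof (intro equalityI subsetI)
  fix p :: "('v, 'k) mpoly" assume "p \<in> augment ` chains 0"
  then obtain z where "p = augment z" by blast
  then have p: "p = (\<Sum>b\<in>D. mon (gen_exp b) * z (b, {}))"
    by (simp add: augment_def)
  have "\<exists>b\<in>D. \<exists>r. m = gen_exp b + r" if m: "m \<in> Poly_Mapping.keys p" for m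
  proof -
    obtain b where "b \<in> D" "m \<in> Poly_Mapping.keys (mon (gen_exp b) * z (b, {}))"
      using m subsetD[OF keys_sum] unfolding p by fast
    then show ?thesis by (auto simp: keys_single_times)
  qed
  then show "p \<in> ?I" by (auto simp: mono_ideal_def)
next
  fix p :: "('v, 'k) mpoly" assume "p \<in> ?I"
  then have "\<exists>q. p = (\<Sum>b\<in>D. mon (gen_exp b) * q b)"
    by (intro mono_ideal_combination[OF finite_D]) (auto simp: mono_ideal_def)
  then obtain q where q: "p = (\<Sum>b\<in>D. mon (gen_exp b) * q b)" ..
  define z where "z = (\<lambda>(b, S :: 'v set). if b \<in> D \<and> S = {} then q b else 0)"
  have "augment z = p" unfolding augment_def q by (rule sum.cong) (auto simp: z_def)
  moreover have "z \<in> chains 0" by (auto simp: z_def chains_def basis_def split: if_splits)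
  ultimately show "p \<in> augment ` chains 0" by blast
qed

end

section \<open>Homogeneous parts and powers of the maximal ideal\<close>

definition homog_part :: "nat \<Rightarrow> ('v::finite, 'k::field) mpoly \<Rightarrow> ('v, 'k) mpoly" where
  "homog_part q p = Abs_poly_mapping (\<lambda>m. if wt UNIV m = q then Poly_Mapping.lookup p m else 0)"

lemma lookup_homog_part:
  "Poly_Mapping.lookup (homog_part q p) m = (if wt UNIV m = q then Poly_Mapping.lookup p m else 0)"
proof -
  have "finite {m. (if wt UNIV m = q then Poly_Mapping.lookup p m else 0) \<noteq> 0}"
    by (rule finite_subset[of _ "Poly_Mapping.keys p"]) (auto simp: in_keys_iff)
  then show ?thesis by (simp add: homog_part_def)
qed

lemma homog_part_zero [simp]: "homog_part q 0 = 0"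
  by (rule poly_mapping_eqI) (simp add: lookup_homog_part)

lemma homog_part_minus: "homog_part q (p - r) = homog_part q p - homog_part q r"
  by (rule poly_mapping_eqI) (simp add: lookup_homog_part lookup_minus)

lemma homog_part_uminus: "homog_part q (- p) = - homog_part q p"
  by (rule poly_mapping_eqI) (simp add: lookup_homog_part)

lemma homog_part_sum: "homog_part q (sum g A) = (\<Sum>a\<in>A. homog_part q (g a))"
  by (rule poly_mapping_eqI) (simp add: lookup_homog_part lookup_sum)

lemma homog_part_idem: "homog_part q (homog_part q p) = homog_part q p"
  by (rule poly_mapping_eqI) (simp add: lookup_homog_part)

lemma homog_part_mon_times:
  assumes "wt UNIV a = d"
  shows "homog_part (d + q) (mon a * p) = mon a * homog_part q p"
proof (rule poly_mapping_eqI)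
  fix m
  show "Poly_Mapping.lookup (homog_part (d + q) (mon a * p)) m = Poly_Mapping.lookup (mon a * homog_part q p) m"
  proof (cases "\<exists>r. m = a + r")
    case True
    with assms show ?thesis by (auto simp: lookup_homog_part lookup_single_times)
  next
    case False
    then have "m \<notin> Poly_Mapping.keys (mon a * p)" "m \<notin> Poly_Mapping.keys (mon a * homog_part q p)"
      unfolding keys_single_times by auto
    then show ?thesis by (simp add: lookup_homog_part in_keys_iff)
  qed
qed

abbreviation max_pow :: "nat \<Rightarrow> ('v::finite, 'k::field) mpoly set" where
  "max_pow k \<equiv> wt_ideal UNIV k"

lemma mono_ideal_UNIV [simp]: "mono_ideal UNIV = UNIV"
  by (simp add: mono_ideal_def)

lemma max_pow_zero [simp]: "0 \<in> max_pow k"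
  by (simp add: mono_ideal_def)

lemma max_pow_mono: "p \<in> max_pow k \<Longrightarrow> j \<le> k \<Longrightarrow> p \<in> max_pow j"
  by (auto simp: mono_ideal_def)

lemma max_pow_add: "p \<in> max_pow k \<Longrightarrow> r \<in> max_pow k \<Longrightarrow> p + r \<in> max_pow k"
  using wt_ideal_is_ideal unfolding is_ideal_def by blast

lemma max_pow_uminus: "p \<in> max_pow k \<Longrightarrow> - p \<in> max_pow k"
  by (auto simp: mono_ideal_def in_keys_iff)

lemma max_pow_minus: "p \<in> max_pow k \<Longrightarrow> r \<in> max_pow k \<Longrightarrow> p - r \<in> max_pow k"
  using max_pow_add[of p k "- r"] max_pow_uminus[of r k] by simp

lemma max_pow_sum: "(\<And>a. a \<in> A \<Longrightarrow> g a \<in> max_pow k) \<Longrightarrow> sum g A \<in> max_pow k"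
  by (rule module.subspace_sum[OF module_mult wt_ideal_is_ideal])

lemma max_pow_scale: "p \<in> max_pow k \<Longrightarrow> r * p \<in> max_pow k"
  using wt_ideal_is_ideal unfolding is_ideal_def by blast

lemma homog_part_in_max_pow: "homog_part q p \<in> max_pow q"
  by (auto simp: mono_ideal_def in_keys_iff lookup_homog_part split: if_splits)

lemma homog_part_eq_0: "p \<in> max_pow (Suc q) \<Longrightarrow> homog_part q p = 0"
  by (rule poly_mapping_eqI) (force simp: mono_ideal_def lookup_homog_part in_keys_iff)

lemma minus_homog_part: "p \<in> max_pow q \<Longrightarrow> p - homog_part q p \<in> max_pow (Suc q)"
  by (force simp: mono_ideal_def lookup_homog_part lookup_minus in_keys_iff subset_iff Suc_le_eq order.strict_iff_order split: if_splits)

lemma var_in_max_pow: "var h \<in> max_pow 1"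
  by (simp add: mono_ideal_def var_def wt_single)

lemma koszul_sign_cases: "koszul_sign h T = 1 \<or> koszul_sign h T = - 1"
  by (auto simp: koszul_sign_def minus_one_power_iff)

lemma homog_part_sign:
  fixes p :: "('v::finite, 'k::field) mpoly"
  shows "homog_part q (koszul_sign h T * p) = koszul_sign h T * homog_part q p"
proof -
  have "koszul_sign h T = (1 :: ('v, 'k) mpoly) \<or> koszul_sign h T = (- 1 :: ('v, 'k) mpoly)"
    by (rule koszul_sign_cases)
  then show ?thesis by (auto simp: homog_part_uminus)
qed

lemma homogeneous_zero: "homogeneous d 0"
  by (simp add: homogeneous_def)

lemma homogeneous_minus: "homogeneous d p \<Longrightarrow> homogeneous d q \<Longrightarrow> homogeneous d (p - q)"
  using keys_diff[of p q] by (auto simp: homogeneous_def)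

lemma homogeneous_sum: "(\<And>a. a \<in> A \<Longrightarrow> homogeneous d (g a)) \<Longrightarrow> homogeneous d (sum g A)"
  using subsetD[OF keys_sum[of g A]] by (fastforce simp: homogeneous_def)

lemma homogeneous_sign:
  fixes p :: "('v::finite, 'k::field) mpoly"
  assumes "homogeneous d p"
  shows "homogeneous d (koszul_sign h T * p)"
proof -
  have "koszul_sign h T = (1 :: ('v, 'k) mpoly) \<or> koszul_sign h T = (- 1 :: ('v, 'k) mpoly)"
    by (rule koszul_sign_cases)
  with assms show ?thesis by (auto simp: homogeneous_def in_keys_iff)
qed

lemma homogeneous_mon: "int (wt UNIV a) = d \<Longrightarrow> homogeneous d (mon a)"
  by (simp add: homogeneous_def mdeg_eq_wt)

context pendant_deficits
begin

section \<open>The linear part of the differential\<close>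

text \<open>The degree 1 part of the coefficient \<open>y\<^sub>h\<close>: all of it if there is just one pendant at \<open>h\<close>, and zero
otherwise.\<close>

definition pendant_lin :: "'v \<Rightarrow> ('v, 'k::field) mpoly" where
  "pendant_lin h = (if wt UNIV (pendant_exp h) = 1 then pendant_prod h else 0)"

lemma pendant_exp_pos:
  assumes "h \<in> X"
  shows "1 \<le> wt UNIV (pendant_exp h)"
proof -
  have "h \<in> f ` (- X)" using assms f_onto by simp
  then obtain w where w: "w \<notin> X" "f w = h" by auto
  have "Poly_Mapping.lookup (pendant_exp h) w \<le> wt UNIV (pendant_exp h)"
    unfolding wt_def by (rule member_le_sum) auto
  with w show ?thesis by (simp add: lookup_pendant_exp)
qed

lemma pendant_prod_in_max_pow: "h \<in> X \<Longrightarrow> pendant_prod h \<in> max_pow 1"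
  using pendant_exp_pos by (simp add: pendant_prod_def mono_ideal_def)

lemma pendant_lin_in_max_pow: "pendant_lin h \<in> max_pow 1"
  by (simp add: pendant_lin_def pendant_prod_def mono_ideal_def)

lemma pendant_prod_minus_lin: "h \<in> X \<Longrightarrow> pendant_prod h - pendant_lin h \<in> max_pow 2"
  using pendant_exp_pos[of h] by (auto simp: pendant_lin_def pendant_prod_def mono_ideal_def)

lemma homog_part_var_times: "homog_part (Suc q) (var h * p) = var h * homog_part q p"
  using homog_part_mon_times[of "Poly_Mapping.single h 1" 1 q p] by (simp add: var_def wt_single)

lemma homog_part_pendant_lin_times: "homog_part (Suc q) (pendant_lin h * p) = pendant_lin h * homog_part q p"
  using homog_part_mon_times[of "pendant_exp h" 1 q p] by (simp add: pendant_lin_def pendant_prod_def)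

lemma homog_part_twisted_diff:
  "homog_part (Suc q) (twisted_diff pendant_lin z \<beta>) = twisted_diff pendant_lin (\<lambda>\<gamma>. homog_part q (z \<gamma>)) \<beta>"
  by (cases \<beta>) (simp add: twisted_diff_def homog_part_sum homog_part_sign homog_part_minus
      homog_part_var_times homog_part_pendant_lin_times)

text \<open>\<open>\<mm>\<^bsup>k\<^esup> F\<^sub>i\<close> in terms of chains.\<close>

definition fil :: "nat \<Rightarrow> nat \<Rightarrow> ('v, 'k::field) chain set" where
  "fil k i = {z \<in> chains i. \<forall>\<beta>. z \<beta> \<in> max_pow k}"

lemma fil_chains: "z \<in> fil k i \<Longrightarrow> z \<in> chains i"
  by (simp add: fil_def)

lemma fil_max_pow: "z \<in> fil k i \<Longrightarrow> z \<beta> \<in> max_pow k"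
  unfolding fil_def by blast

lemma fil_0: "fil 0 i = chains i"
  by (simp add: fil_def)

lemma fil_zero [simp]: "(\<lambda>\<beta>. 0) \<in> fil k i"
  by (simp add: fil_def chains_def)

lemma fil_add: "y \<in> fil k i \<Longrightarrow> z \<in> fil k i \<Longrightarrow> (\<lambda>\<beta>. y \<beta> + z \<beta>) \<in> fil k i"
  by (simp add: fil_def chains_add max_pow_add)

lemma fil_minus: "y \<in> fil k i \<Longrightarrow> z \<in> fil k i \<Longrightarrow> (\<lambda>\<beta>. y \<beta> - z \<beta>) \<in> fil k i"
  by (simp add: fil_def chains_minus max_pow_minus)

lemma fil_mono: "z \<in> fil k i \<Longrightarrow> j \<le> k \<Longrightarrow> z \<in> fil j i"
  unfolding fil_def using max_pow_mono by blast

text \<open>Shifts by a vertex outside \<open>X\<close> never contribute. This matters because \<open>pendant_prod h = 1\<close> for such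
\<open>h\<close>.\<close>

lemma chains_inc:
  assumes "z \<in> chains i" "z (inc h b, S) \<noteq> 0"
  shows "h \<in> X"
proof -
  have "inc h b \<in> D" using assms by (auto simp: chains_def basis_def)
  from off[OF this, of h] show ?thesis by auto
qed

lemma twisted_diff_fil:
  assumes z: "z \<in> fil k (Suc i)" and c: "\<And>h. h \<in> X \<Longrightarrow> c h \<in> max_pow 1"
  shows "twisted_diff c z \<in> fil (Suc k) i"
proof -
  have "twisted_diff c z (b, T) \<in> max_pow (Suc k)" for b T
    unfolding twisted_diff_def prod.case
  proof (rule max_pow_sum, rule max_pow_scale, rule max_pow_minus)
    fix h
    have zk: "z \<beta> \<in> max_pow k" for \<beta> using z by (rule fil_max_pow)
    show "var h * z (b, insert h T) \<in> max_pow (Suc k)"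
      using wt_ideal_mult[OF var_in_max_pow zk] by simp
    show "c h * z (inc h b, insert h T) \<in> max_pow (Suc k)"
    proof (cases "z (inc h b, insert h T) = 0")
      case False
      then have "h \<in> X" by (rule chains_inc[OF fil_chains[OF z]])
      from wt_ideal_mult[OF c[OF this] zk] show ?thesis by simp
    qed simp
  qed
  then show ?thesis using z twisted_diff_chains by (auto simp: fil_def)
qed

lemma twisted_diff_minus_lin:
  fixes z :: "('v, 'k::field) chain"
  assumes z: "z \<in> fil k (Suc i)"
  shows "(\<lambda>\<beta>. twisted_diff pendant_prod z \<beta> - twisted_diff pendant_lin z \<beta>) \<in> fil (k + 2) i"
proof -
  have "twisted_diff pendant_prod z (b, T) - twisted_diff pendant_lin z (b, T) \<in> max_pow (k + 2)" for b T
  proof -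
    have "twisted_diff pendant_prod z (b, T) - twisted_diff pendant_lin z (b, T)
        = (\<Sum>h\<in>-T. (- koszul_sign h T) * ((pendant_prod h - pendant_lin h) * z (inc h b, insert h T)))"
      unfolding twisted_diff_def prod.case sum_subtractf[symmetric]
      by (intro sum.cong refl) (simp add: algebra_simps)
    also have "\<dots> \<in> max_pow (k + 2)"
    proof (rule max_pow_sum, rule max_pow_scale)
      fix h
      show "(pendant_prod h - pendant_lin h) * z (inc h b, insert h T) \<in> max_pow (k + 2)"
      proof (cases "z (inc h b, insert h T) = 0")
        case False
        then have h: "h \<in> X" by (rule chains_inc[OF fil_chains[OF z]])
        have "z (inc h b, insert h T) \<in> max_pow k" using z by (rule fil_max_pow)
        from wt_ideal_mult[OF pendant_prod_minus_lin[OF h] this] show ?thesis by (simp add: add.commute)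
      qed simp
    qed
    finally show ?thesis .
  qed
  then show ?thesis using z twisted_diff_chains by (auto simp: fil_def intro!: chains_minus)
qed

text \<open>Exactness of the linear part, stated on representatives. The part \<open>x\<close> of \<open>z\<close> of degree exactly \<open>q\<close> is a
cycle of the linear part of the differential, hence a boundary by \<open>twisted_diff_exact\<close>; since this
differential raises degrees by exactly one, a preimage can be chosen homogeneous of degree \<open>q - 1\<close>, and for
\<open>q = 0\<close> it follows that \<open>x = 0\<close>. All errors committed lie one step further down the filtration.\<close>

lemma linear_part_exact:
  fixes z :: "('v, 'k::field) chain"
  assumes z: "z \<in> fil q (Suc i)" and dz: "twisted_diff pendant_prod z \<in> fil (q + 2) i"
  shows "\<exists>y\<in>fil (q - 1) (Suc (Suc i)). (\<lambda>\<beta>. z \<beta> - twisted_diff pendant_prod y \<beta>) \<in> fil (Suc q) (Suc i)"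
proof -
  define x where "x \<beta> = homog_part q (z \<beta>)" for \<beta>
  have x: "x \<in> chains (Suc i)" using fil_chains[OF z] by (force simp: x_def chains_def)
  have "twisted_diff pendant_lin x = (\<lambda>\<beta>. 0)"
  proof
    fix \<beta>
    have "twisted_diff pendant_prod z \<beta> \<in> max_pow (q + 2)" using dz by (rule fil_max_pow)
    moreover have "twisted_diff pendant_prod z \<beta> - twisted_diff pendant_lin z \<beta> \<in> max_pow (q + 2)"
      using fil_max_pow[OF twisted_diff_minus_lin[OF z]] .
    ultimately have "twisted_diff pendant_prod z \<beta>
        - (twisted_diff pendant_prod z \<beta> - twisted_diff pendant_lin z \<beta>) \<in> max_pow (q + 2)"
      by (rule max_pow_minus)
    then have "homog_part (Suc q) (twisted_diff pendant_lin z \<beta>) = 0"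
      by (intro homog_part_eq_0) simp
    then show "twisted_diff pendant_lin x \<beta> = 0" by (simp add: homog_part_twisted_diff x_def[abs_def])
  qed
  from twisted_diff_exact[OF x this] obtain y0 where
    y0: "y0 \<in> chains (Suc (Suc i))" "twisted_diff pendant_lin y0 = x" by blast
  have zx: "(\<lambda>\<beta>. z \<beta> - x \<beta>) \<in> fil (Suc q) (Suc i)"
  proof -
    have "z \<beta> - x \<beta> \<in> max_pow (Suc q)" for \<beta>
      unfolding x_def by (rule minus_homog_part) (rule fil_max_pow[OF z])
    with chains_minus[OF fil_chains[OF z] x] show ?thesis unfolding fil_def by blast
  qed
  show ?thesis
  proof (cases q)
    case 0
    have "x \<beta> = 0" for \<beta>
    proof -
      have "twisted_diff pendant_lin y0 \<in> fil (Suc 0) (Suc i)"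
        by (rule twisted_diff_fil) (use y0 pendant_lin_in_max_pow in \<open>auto simp: fil_0\<close>)
      then have "homog_part 0 (x \<beta>) = 0" unfolding y0(2) by (intro homog_part_eq_0) (rule fil_max_pow)
      then show ?thesis by (simp add: x_def 0 homog_part_idem)
    qed
    with zx have "(\<lambda>\<beta>. z \<beta> - twisted_diff pendant_prod (\<lambda>\<beta>. 0) \<beta>) \<in> fil (Suc q) (Suc i)" by simp
    then show ?thesis by (intro bexI[of _ "\<lambda>\<beta>. 0"]) simp_all
  next
    case (Suc r)
    define y where "y \<beta> = homog_part r (y0 \<beta>)" for \<beta>
    have y: "y \<in> fil r (Suc (Suc i))"
      using y0(1) homog_part_in_max_pow by (force simp: y_def fil_def chains_def)
    have "twisted_diff pendant_lin y = x"
    proof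
      fix \<beta>
      have "twisted_diff pendant_lin y \<beta> = homog_part q (x \<beta>)"
        unfolding Suc y0(2)[symmetric] homog_part_twisted_diff by (simp add: y_def[abs_def])
      then show "twisted_diff pendant_lin y \<beta> = x \<beta>" by (simp add: x_def homog_part_idem)
    qed
    with twisted_diff_minus_lin[OF y] Suc
    have "(\<lambda>\<beta>. twisted_diff pendant_prod y \<beta> - x \<beta>) \<in> fil (Suc q) (Suc i)" by simp
    from fil_minus[OF zx this] y show ?thesis by (intro bexI[of _ y]) (simp_all add: Suc)
  qed
qed

end

context down_closed
begin

section \<open>The differentials as matrices\<close>

definition basis_list :: "nat \<Rightarrow> (('v \<Rightarrow> nat) \<times> 'v set) list" where
  "basis_list i = (SOME xs. set xs = basis i \<and> distinct xs)"

lemma basis_list: "set (basis_list i) = basis i" "distinct (basis_list i)"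
  using someI_ex[OF finite_distinct_list[OF finite_basis[of i]]] by (auto simp: basis_list_def)

abbreviation rank :: "nat \<Rightarrow> nat" where
  "rank i \<equiv> card (basis i)"

lemma length_basis_list: "length (basis_list i) = rank i"
  using distinct_card[OF basis_list(2)] basis_list(1) by metis

lemma nth_basis_list: "j < rank i \<Longrightarrow> basis_list i ! j \<in> basis i"
  using nth_mem[of j "basis_list i"] by (simp add: basis_list length_basis_list)

lemma ex_nth_basis_list: "\<beta> \<in> basis i \<Longrightarrow> \<exists>j<rank i. basis_list i ! j = \<beta>"
  using basis_list(1)[of i] by (metis in_set_conv_nth length_basis_list)

lemma sum_basis_list: "(\<Sum>j<rank i. g (basis_list i ! j)) = (\<Sum>\<beta>\<in>basis i. g \<beta>)"
proof (rule sum.reindex_bij_betw)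
  show "bij_betw ((!) (basis_list i)) {..<rank i} (basis i)"
    by (rule bij_betw_nth) (simp_all add: basis_list length_basis_list)
qed

definition to_vec :: "nat \<Rightarrow> ('v, 'k::field) chain \<Rightarrow> ('v, 'k) mpoly vec" where
  "to_vec i z = vec (rank i) (\<lambda>j. z (basis_list i ! j))"

lemma to_vec_carrier [simp]: "to_vec i z \<in> carrier_vec (rank i)"
  by (simp add: to_vec_def)

lemma to_vec_add: "to_vec i (\<lambda>\<beta>. y \<beta> + z \<beta>) = to_vec i y + to_vec i z"
  by (rule eq_vecI) (simp_all add: to_vec_def)

lemma to_vec_0: "to_vec i (\<lambda>\<beta>. 0) = 0\<^sub>v (rank i)"
  by (rule eq_vecI) (simp_all add: to_vec_def)

lemma to_vec_inj:
  assumes "y \<in> chains i" "z \<in> chains i" "to_vec i y = to_vec i z"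
  shows "y = z"
proof
  fix \<beta>
  show "y \<beta> = z \<beta>"
  proof (cases "\<beta> \<in> basis i")
    case True
    then obtain j where j: "j < rank i" "basis_list i ! j = \<beta>" using ex_nth_basis_list by blast
    have "to_vec i y $ j = to_vec i z $ j" using assms(3) by simp
    with j show ?thesis by (simp add: to_vec_def)
  next
    case False
    with assms(1,2) show ?thesis by (simp add: chains_zero_outside)
  qed
qed

lemma carrier_vec_eq: "carrier_vec (rank i) = to_vec i ` (chains i :: ('v, 'k::field) chain set)"
proof (intro equalityI subsetI)
  fix x :: "('v, 'k) mpoly vec" assume x: "x \<in> carrier_vec (rank i)"
  define pos where "pos \<beta> = (SOME j. j < rank i \<and> basis_list i ! j = \<beta>)" for \<beta>
  have pos: "pos (basis_list i ! j) = j" if "j < rank i" for j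
  proof -
    have "pos (basis_list i ! j) < rank i \<and> basis_list i ! pos (basis_list i ! j) = basis_list i ! j"
      unfolding pos_def by (rule someI[of _ j]) (simp add: that)
    then show ?thesis using that by (metis basis_list(2) length_basis_list nth_eq_iff_index_eq)
  qed
  define z where "z \<beta> = (if \<beta> \<in> basis i then x $ pos \<beta> else 0)" for \<beta>
  have "to_vec i z = x"
    by (rule eq_vecI) (use x in \<open>auto simp: to_vec_def z_def nth_basis_list pos\<close>)
  moreover have "z \<in> chains i" by (simp add: z_def chains_def)
  ultimately show "x \<in> to_vec i ` chains i" by blast
qed auto

definition unit_chain :: "('v \<Rightarrow> nat) \<times> 'v set \<Rightarrow> ('v, 'k::field) chain" where
  "unit_chain \<beta> = (\<lambda>\<gamma>. if \<gamma> = \<beta> then 1 else 0)"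

lemma unit_chain_chains: "\<beta> \<in> basis i \<Longrightarrow> unit_chain \<beta> \<in> chains i"
  by (simp add: unit_chain_def chains_def)

lemma chain_expand:
  assumes "z \<in> chains i"
  shows "z = (\<lambda>\<gamma>. \<Sum>\<beta>\<in>basis i. z \<beta> * unit_chain \<beta> \<gamma>)"
proof
  fix \<gamma>
  show "z \<gamma> = (\<Sum>\<beta>\<in>basis i. z \<beta> * unit_chain \<beta> \<gamma>)"
    using chains_zero_outside[OF assms, of \<gamma>] finite_basis[of i]
    by (simp add: unit_chain_def if_distrib[of "\<lambda>x. _ * x"] sum.delta cong: if_cong)
qed

definition diff_mat :: "('v \<Rightarrow> ('v, 'k::field) mpoly) \<Rightarrow> nat \<Rightarrow> ('v, 'k) mpoly mat" where
  "diff_mat c i = mat (rank i) (rank (Suc i))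
     (\<lambda>(j, k). twisted_diff c (unit_chain (basis_list (Suc i) ! k)) (basis_list i ! j))"

lemma diff_mat_carrier [simp]: "diff_mat c i \<in> carrier_mat (rank i) (rank (Suc i))"
  by (simp add: diff_mat_def)

lemma diff_mat_mult_vec:
  fixes z :: "('v, 'k::field) chain"
  assumes z: "z \<in> chains (Suc i)"
  shows "diff_mat c i *\<^sub>v to_vec (Suc i) z = to_vec i (twisted_diff c z)"
proof (rule eq_vecI)
  fix j assume "j < dim_vec (to_vec i (twisted_diff c z))"
  then have j: "j < rank i" by (simp add: to_vec_def)
  have "(diff_mat c i *\<^sub>v to_vec (Suc i) z) $ j
      = (\<Sum>k<rank (Suc i). twisted_diff c (unit_chain (basis_list (Suc i) ! k)) (basis_list i ! j) * z (basis_list (Suc i) ! k))"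
    using j by (simp add: diff_mat_def to_vec_def scalar_prod_def lessThan_atLeast0)
  also have "\<dots> = (\<Sum>\<beta>\<in>basis (Suc i). twisted_diff c (unit_chain \<beta>) (basis_list i ! j) * z \<beta>)"
    by (rule sum_basis_list)
  also have "\<dots> = twisted_diff c (\<lambda>\<gamma>. \<Sum>\<beta>\<in>basis (Suc i). z \<beta> * unit_chain \<beta> \<gamma>) (basis_list i ! j)"
    by (simp add: twisted_diff_sum twisted_diff_scale mult.commute)
  also have "\<dots> = to_vec i (twisted_diff c z) $ j"
    using j chain_expand[OF z, symmetric] by (simp add: to_vec_def)
  finally show "(diff_mat c i *\<^sub>v to_vec (Suc i) z) $ j = to_vec i (twisted_diff c z) $ j" .
qed (simp add: diff_mat_def to_vec_def)

lemma diff_mat_mult: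
  fixes c :: "'v \<Rightarrow> ('v, 'k::field) mpoly"
  shows "diff_mat c i * diff_mat c (Suc i) = 0\<^sub>m (rank i) (rank (Suc (Suc i)))"
proof (rule eq_matI)
  fix j k assume "j < dim_row (0\<^sub>m (rank i) (rank (Suc (Suc i))))" "k < dim_col (0\<^sub>m (rank i) (rank (Suc (Suc i))))"
  then have jk: "j < rank i" "k < rank (Suc (Suc i))" by simp_all
  let ?u = "unit_chain (basis_list (Suc (Suc i)) ! k) :: ('v, 'k) chain"
  have "col (diff_mat c (Suc i)) k = to_vec (Suc i) (twisted_diff c ?u)"
    using jk by (intro eq_vecI) (simp_all add: diff_mat_def to_vec_def)
  moreover have "?u \<in> chains (Suc (Suc i))" using jk by (intro unit_chain_chains nth_basis_list)
  ultimately have "diff_mat c i *\<^sub>v col (diff_mat c (Suc i)) k = to_vec i (\<lambda>\<beta>. 0)"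
    by (simp add: diff_mat_mult_vec twisted_diff_chains twisted_diff_twisted_diff)
  moreover have "col (diff_mat c i * diff_mat c (Suc i)) k = diff_mat c i *\<^sub>v col (diff_mat c (Suc i)) k"
    by (rule col_mult2[OF diff_mat_carrier diff_mat_carrier jk(2)])
  ultimately have "col (diff_mat c i * diff_mat c (Suc i)) k = 0\<^sub>v (rank i)"
    by (simp add: to_vec_0)
  then have "col (diff_mat c i * diff_mat c (Suc i)) k $ j = 0" using jk by simp
  then show "(diff_mat c i * diff_mat c (Suc i)) $$ (j, k) = 0\<^sub>m (rank i) (rank (Suc (Suc i))) $$ (j, k)"
    using jk by (simp add: diff_mat_def)
qed (simp_all add: diff_mat_def)

end

context pendant_deficits
begin

section \<open>The minimal graded free resolution\<close>

text \<open>The basis element \<open>(b, S)\<close> has the degree of the monomial \<open>u\<^sub>b \<Prod>\<^bsub>h \<in> S\<^esub> x\<^sub>h\<close>.\<close>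

definition resolution :: "('v, 'k::field) mpoly free_complex" where
  "resolution = \<lparr>rk = rank,
     shift = (\<lambda>i j. int (wt UNIV (gen_exp (fst (basis_list i ! j))) + i)),
     diff = diff_mat pendant_prod\<rparr>"

lemma resolution_simps [simp]:
  "rk resolution = rank" "diff resolution = diff_mat pendant_prod"
  by (simp_all add: resolution_def)

definition augment_vec :: "('v, 'k::field) mpoly vec" where
  "augment_vec = vec (rank 0) (\<lambda>j. mon (gen_exp (fst (basis_list 0 ! j))))"

lemma augment_vec_scalar_prod:
  fixes z :: "('v, 'k::field) chain"
  shows "augment_vec \<bullet> to_vec 0 z = augment z"
proof -
  have "augment_vec \<bullet> to_vec 0 z = (\<Sum>j<rank 0. mon (gen_exp (fst (basis_list 0 ! j))) * z (basis_list 0 ! j))"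
    by (simp add: augment_vec_def to_vec_def scalar_prod_def lessThan_atLeast0)
  also have "\<dots> = (\<Sum>\<beta>\<in>basis 0. mon (gen_exp (fst \<beta>)) * z \<beta>)"
    by (rule sum_basis_list)
  also have "basis 0 = (\<lambda>b. (b, {})) ` D"
    by (auto simp: basis_def)
  also have "(\<Sum>\<beta>\<in>(\<lambda>b. (b, {})) ` D. mon (gen_exp (fst \<beta>)) * z \<beta>) = augment z"
    unfolding augment_def by (subst sum.reindex) (auto simp: inj_on_def)
  finally show ?thesis .
qed

text \<open>The entry \<open>x\<^sub>h\<close> is homogeneous of degree 1, and \<open>y\<^sub>h\<close> of degree \<open>deg u\<^sub>b + 1 - deg u\<^sub>a\<close> for \<open>b = a + e\<^sub>h\<close>,
by \<open>gen_exp_inc\<close>.\<close>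

lemma homogeneous_entry:
  assumes \<beta>: "(b, S) \<in> basis (Suc i)" and \<alpha>: "(a, T) \<in> basis i"
  shows "homogeneous (int (wt UNIV (gen_exp b) + Suc i) - int (wt UNIV (gen_exp a) + i))
           (twisted_diff pendant_prod (unit_chain (b, S)) (a, T) :: ('v, 'k::field) mpoly)"
  unfolding twisted_diff_def prod.case
proof (rule homogeneous_sum, rule homogeneous_sign, rule homogeneous_minus)
  fix h
  let ?d = "int (wt UNIV (gen_exp b) + Suc i) - int (wt UNIV (gen_exp a) + i)"
  show "homogeneous ?d (var h * unit_chain (b, S) (a, insert h T) :: ('v, 'k) mpoly)"
  proof (cases "(a, insert h T) = (b, S)")
    case True
    then show ?thesis by (auto simp: unit_chain_def var_def wt_single intro: homogeneous_mon)
  next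
    case False
    then show ?thesis by (auto simp: unit_chain_def homogeneous_zero)
  qed
  show "homogeneous ?d (pendant_prod h * unit_chain (b, S) (inc h a, insert h T) :: ('v, 'k) mpoly)"
  proof (cases "(inc h a, insert h T) = (b, S)")
    case True
    then have b: "b = inc h a" by simp
    with \<beta> have "inc h a \<in> D" by (simp add: basis_def)
    from arg_cong[OF gen_exp_inc[OF this], of "wt UNIV"]
    have "wt UNIV (gen_exp a) + wt UNIV (pendant_exp h) = wt UNIV (gen_exp b) + 1"
      by (simp add: b wt_single)
    then have "homogeneous ?d (pendant_prod h :: ('v, 'k) mpoly)"
      unfolding pendant_prod_def by (intro homogeneous_mon) linarith
    then show ?thesis using True by (simp add: unit_chain_def)
  next
    case False
    then show ?thesis by (auto simp: unit_chain_def homogeneous_zero)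
  qed
qed

lemma graded_free_complex_resolution: "graded_free_complex (resolution :: ('v, 'k::field) mpoly free_complex)"
  unfolding graded_free_complex_def resolution_simps
proof (intro conjI allI impI)
  fix i j k assume jk: "j < rank i" "k < rank (Suc i)"
  obtain b S where b: "basis_list (Suc i) ! k = (b, S)" by fastforce
  obtain a T where a: "basis_list i ! j = (a, T)" by fastforce
  show "homogeneous (shift resolution (Suc i) k - shift resolution i j)
     (diff_mat pendant_prod i $$ (j, k) :: ('v, 'k) mpoly)"
    using homogeneous_entry[of b S i a T] nth_basis_list[OF jk(1)] nth_basis_list[OF jk(2)] jk
    by (simp add: resolution_def diff_mat_def a b algebra_simps)
qed (simp_all add: diff_mat_mult)

lemma graded_free_resolution_resolution:
  "graded_free_resolution resolution augment_vec
     (mono_ideal {m. \<exists>b\<in>D. \<exists>r. m = gen_exp b + r} :: ('v, 'k::field) mpoly set)"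
  unfolding graded_free_resolution_def resolution_simps
proof (intro conjI allI impI)
  show "graded_free_complex (resolution :: ('v, 'k) mpoly free_complex)"
    by (rule graded_free_complex_resolution)
  show "(augment_vec :: ('v, 'k) mpoly vec) \<in> carrier_vec (rank 0)" by (simp add: augment_vec_def)
  show "homogeneous (shift resolution 0 j) (augment_vec $ j :: ('v, 'k) mpoly)" if "j < rank 0" for j
    using that by (auto simp: augment_vec_def resolution_def intro: homogeneous_mon)
  show "(\<lambda>x. augment_vec \<bullet> x) ` carrier_vec (rank 0)
      = (mono_ideal {m. \<exists>b\<in>D. \<exists>r. m = gen_exp b + r} :: ('v, 'k) mpoly set)"
    unfolding carrier_vec_eq image_image augment_vec_scalar_prod augment_image ..
  show "{x \<in> carrier_vec (rank 0). augment_vec \<bullet> x = (0 :: ('v, 'k) mpoly)}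
      = (\<lambda>y. diff_mat pendant_prod 0 *\<^sub>v y) ` carrier_vec (rank 1)" (is "?L = ?R")
  proof (intro equalityI subsetI)
    fix x assume "x \<in> ?L"
    then obtain z :: "('v, 'k) chain" where z: "z \<in> chains 0" "x = to_vec 0 z" "augment z = 0"
      by (auto simp: carrier_vec_eq augment_vec_scalar_prod)
    then obtain y where "y \<in> chains (Suc 0)" "twisted_diff pendant_prod y = z"
      using augment_exact by blast
    with z(2) show "x \<in> ?R" by (auto simp: carrier_vec_eq diff_mat_mult_vec image_image)
  next
    fix x assume "x \<in> ?R"
    then obtain y :: "('v, 'k) chain" where y: "y \<in> chains (Suc 0)" "x = to_vec 0 (twisted_diff pendant_prod y)"
      by (auto simp: carrier_vec_eq diff_mat_mult_vec)
    then show "x \<in> ?L" by (simp add: augment_vec_scalar_prod augment_twisted_diff)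
  qed
  show "{x \<in> carrier_vec (rank (Suc i)). diff_mat pendant_prod i *\<^sub>v x = (0\<^sub>v (rank i) :: ('v, 'k) mpoly vec)}
      = (\<lambda>y. diff_mat pendant_prod (Suc i) *\<^sub>v y) ` carrier_vec (rank (Suc (Suc i)))" (is "?L = ?R") for i
  proof (intro equalityI subsetI)
    fix x assume "x \<in> ?L"
    then obtain z :: "('v, 'k) chain" where z: "z \<in> chains (Suc i)" "x = to_vec (Suc i) z"
      "to_vec i (twisted_diff pendant_prod z) = to_vec i (\<lambda>\<beta>. 0)"
      by (auto simp: carrier_vec_eq diff_mat_mult_vec to_vec_0)
    have "twisted_diff pendant_prod z = (\<lambda>\<beta>. 0)"
      by (rule to_vec_inj[OF twisted_diff_chains[OF z(1)] fil_chains[OF fil_zero[of 0]] z(3)])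
    with z(1) obtain y where "y \<in> chains (Suc (Suc i))" "twisted_diff pendant_prod y = z"
      using twisted_diff_exact by blast
    with z(2) show "x \<in> ?R" by (auto simp: carrier_vec_eq diff_mat_mult_vec image_image)
  next
    fix x assume "x \<in> ?R"
    then obtain y :: "('v, 'k) chain" where y: "y \<in> chains (Suc (Suc i))" "x = to_vec (Suc i) (twisted_diff pendant_prod y)"
      by (auto simp: carrier_vec_eq diff_mat_mult_vec)
    then show "x \<in> ?L"
      by (simp add: diff_mat_mult_vec twisted_diff_chains twisted_diff_twisted_diff to_vec_0)
  qed
qed

lemma max_power_free_eq:
  "max_power_free k (rank i) = to_vec i ` (fil k i :: ('v, 'k::field) chain set)"
proof (intro equalityI subsetI)
  fix x :: "('v, 'k) mpoly vec" assume x: "x \<in> max_power_free k (rank i)"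
  then obtain z where z: "z \<in> chains i" "x = to_vec i z"
    by (auto simp: max_power_free_def carrier_vec_eq)
  have "z \<beta> \<in> max_pow k" for \<beta>
  proof (cases "\<beta> \<in> basis i")
    case True
    then obtain j where "j < rank i" "basis_list i ! j = \<beta>" using ex_nth_basis_list by blast
    then show ?thesis using x z(2) by (auto simp: max_power_free_def ideal_power_max_ideal to_vec_def)
  next
    case False
    then show ?thesis using z(1) by (simp add: chains_zero_outside)
  qed
  with z show "x \<in> to_vec i ` fil k i" unfolding fil_def by blast
next
  fix x :: "('v, 'k) mpoly vec" assume "x \<in> to_vec i ` fil k i"
  then obtain z where z: "z \<in> fil k i" "x = to_vec i z" by blast
  then show "x \<in> max_power_free k (rank i)"
    using fil_max_pow[OF z(1)] by (simp add: max_power_free_def ideal_power_max_ideal to_vec_def)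
qed

lemma minimal_complex_resolution: "minimal_complex (resolution :: ('v, 'k::field) mpoly free_complex)"
  unfolding minimal_complex_def resolution_simps
proof (intro allI subsetI)
  fix i and x :: "('v, 'k) mpoly vec"
  assume "x \<in> (\<lambda>x. diff_mat pendant_prod i *\<^sub>v x) ` carrier_vec (rank (Suc i))"
  then obtain z :: "('v, 'k) chain" where z: "z \<in> chains (Suc i)" "x = to_vec i (twisted_diff pendant_prod z)"
    by (auto simp: carrier_vec_eq diff_mat_mult_vec)
  have "twisted_diff pendant_prod z \<in> fil (Suc 0) i"
    by (rule twisted_diff_fil) (use z pendant_prod_in_max_pow in \<open>auto simp: fil_0\<close>)
  with z(2) show "x \<in> max_power_free 1 (rank i)" by (simp add: max_power_free_eq)
qed

section \<open>Acyclicity of the linear part\<close>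

lemma filt_resolution: "filt resolution p i = to_vec i ` (fil (p - i) i :: ('v, 'k::field) chain set)"
  by (simp add: filt_def max_power_free_eq)

text \<open>The class of a chain in the \<open>p\<close>-th graded piece of the linear part.\<close>

definition gr_coset :: "nat \<Rightarrow> nat \<Rightarrow> ('v, 'k::field) chain \<Rightarrow> ('v, 'k) mpoly vec set" where
  "gr_coset p i z = {to_vec i z + y | y. y \<in> filt resolution (Suc p) i}"

lemma gr_resolution: "gr resolution p i = gr_coset p i ` (fil (p - i) i :: ('v, 'k::field) chain set)"
  by (simp add: gr_def filt_resolution[of p] image_image gr_coset_def)

lemma gr_coset_alt:
  "gr_coset p i z = (\<lambda>w. to_vec i (\<lambda>\<beta>. z \<beta> + w \<beta>)) ` (fil (Suc p - i) i :: ('v, 'k::field) chain set)"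
  unfolding gr_coset_def filt_resolution to_vec_add by blast

lemma gr_coset_0: "gr_coset p i (\<lambda>\<beta>. 0) = (filt resolution (Suc p) i :: ('v, 'k::field) mpoly vec set)"
  unfolding gr_coset_alt filt_resolution by simp

lemma gr_coset_eq_iff:
  fixes z z' :: "('v, 'k::field) chain"
  assumes z: "z \<in> chains i" "z' \<in> chains i"
  shows "gr_coset p i z = gr_coset p i z' \<longleftrightarrow> (\<lambda>\<beta>. z \<beta> - z' \<beta>) \<in> fil (Suc p - i) i"
proof
  assume eq: "gr_coset p i z = gr_coset p i z'"
  have "to_vec i (\<lambda>\<beta>. z \<beta> + 0) \<in> gr_coset p i z"
    unfolding gr_coset_alt by (rule imageI) simp
  then obtain w where w: "w \<in> fil (Suc p - i) i" "to_vec i z = to_vec i (\<lambda>\<beta>. z' \<beta> + w \<beta>)"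
    unfolding eq by (auto simp: gr_coset_alt)
  have "z = (\<lambda>\<beta>. z' \<beta> + w \<beta>)"
    by (rule to_vec_inj[OF z(1) _ w(2)]) (intro chains_add z(2) fil_chains[OF w(1)])
  with w(1) show "(\<lambda>\<beta>. z \<beta> - z' \<beta>) \<in> fil (Suc p - i) i" by simp
next
  have sub: "gr_coset p i z \<subseteq> gr_coset p i z'" if d: "(\<lambda>\<beta>. z \<beta> - z' \<beta>) \<in> fil (Suc p - i) i" for z z' :: "('v, 'k) chain"
  proof
    fix x assume "x \<in> gr_coset p i z"
    then obtain w where w: "w \<in> fil (Suc p - i) i" "x = to_vec i (\<lambda>\<beta>. z \<beta> + w \<beta>)" by (auto simp: gr_coset_alt)
    show "x \<in> gr_coset p i z'"
      unfolding gr_coset_alt by (rule image_eqI[OF _ fil_add[OF d w(1)]]) (simp add: w(2))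
  qed
  assume d: "(\<lambda>\<beta>. z \<beta> - z' \<beta>) \<in> fil (Suc p - i) i"
  from fil_minus[OF fil_zero d] have "(\<lambda>\<beta>. z' \<beta> - z \<beta>) \<in> fil (Suc p - i) i" by simp
  with d sub show "gr_coset p i z = gr_coset p i z'" by blast
qed

lemma gr_coset_eq_filt_iff:
  fixes z :: "('v, 'k::field) chain"
  assumes "z \<in> chains i"
  shows "gr_coset p i z = filt resolution (Suc p) i \<longleftrightarrow> z \<in> fil (Suc p - i) i"
  using gr_coset_eq_iff[OF assms fil_chains[OF fil_zero], of p] by (simp add: gr_coset_0)

lemma twisted_diff_fil_step:
  assumes "z \<in> fil (p - Suc i) (Suc i)"
  shows "twisted_diff pendant_prod z \<in> fil (p - i) i"
  by (rule fil_mono[OF twisted_diff_fil[OF assms pendant_prod_in_max_pow]]) auto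

text \<open>The differential of the linear part is computed on representatives, since the differential maps
each filtration step into the corresponding one.\<close>

lemma lin_diff_gr_coset:
  fixes z :: "('v, 'k::field) chain"
  assumes z: "z \<in> chains (Suc i)" and X: "Z p = gr_coset p (Suc i) z"
  shows "lin_diff resolution i Z p = gr_coset p i (twisted_diff pendant_prod z)"
proof (intro equalityI subsetI)
  fix v assume "v \<in> lin_diff resolution i Z p"
  then obtain x y where v: "v = diff_mat pendant_prod i *\<^sub>v x + y" "x \<in> Z p" "y \<in> filt resolution (Suc p) i"
    by (auto simp: lin_diff_def)
  obtain w where w: "w \<in> fil (Suc p - Suc i) (Suc i)" "x = to_vec (Suc i) (\<lambda>\<beta>. z \<beta> + w \<beta>)"
    using v(2) unfolding X gr_coset_alt by blast
  obtain u where u: "u \<in> fil (Suc p - i) i" "y = to_vec i u" using v(3) by (auto simp: filt_resolution)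
  have "v = to_vec i (\<lambda>\<beta>. twisted_diff pendant_prod z \<beta> + (twisted_diff pendant_prod w \<beta> + u \<beta>))"
    unfolding v(1) w(2) u(2) diff_mat_mult_vec[OF chains_add[OF z fil_chains[OF w(1)]]] twisted_diff_add
    by (simp add: to_vec_add[symmetric] add.assoc)
  then show "v \<in> gr_coset p i (twisted_diff pendant_prod z)"
    unfolding gr_coset_alt by (rule image_eqI[OF _ fil_add[OF twisted_diff_fil_step[OF w(1)] u(1)]])
next
  fix v assume "v \<in> gr_coset p i (twisted_diff pendant_prod z)"
  then obtain y where y: "y \<in> filt resolution (Suc p) i" "v = to_vec i (twisted_diff pendant_prod z) + y"
    by (auto simp: gr_coset_def)
  have "to_vec (Suc i) (\<lambda>\<beta>. z \<beta> + 0) \<in> Z p"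
    unfolding X gr_coset_alt by (rule imageI) simp
  then have "to_vec (Suc i) z \<in> Z p" by simp
  moreover have "v = diff_mat pendant_prod i *\<^sub>v to_vec (Suc i) z + y"
    by (simp add: y(2) diff_mat_mult_vec[OF z])
  ultimately show "v \<in> lin_diff resolution i Z p"
    unfolding lin_diff_def resolution_simps using y(1) by blast
qed

lemma lin_part_resolution:
  "(Z :: nat \<Rightarrow> ('v, 'k::field) mpoly vec set) \<in> lin_part resolution i \<longleftrightarrow>
     (\<exists>z. (\<forall>p. z p \<in> fil (p - i) i \<and> Z p = gr_coset p i (z p)) \<and> finite {p. z p \<notin> fil (Suc p - i) i})"
proof -
  have "(\<forall>p. Z p \<in> gr resolution p i) \<longleftrightarrow> (\<exists>z. \<forall>p. z p \<in> fil (p - i) i \<and> Z p = gr_coset p i (z p))"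
    unfolding gr_resolution image_iff by metis
  moreover have "{p. Z p \<noteq> filt resolution (Suc p) i} = {p. z p \<notin> fil (Suc p - i) i}"
    if "\<forall>p. z p \<in> fil (p - i) i \<and> Z p = gr_coset p i (z p)" for z
    using that gr_coset_eq_filt_iff fil_chains by metis
  ultimately show ?thesis unfolding lin_part_def by auto
qed

text \<open>Graded piece by graded piece, a cycle is lifted by \<open>linear_part_exact\<close>. The zero class is lifted
to zero, so that only finitely many pieces of the lift are nonzero.\<close>

lemma lin_cycles_eq_boundaries:
  "lin_cycles (resolution :: ('v, 'k::field) mpoly free_complex) (Suc i) = lin_boundaries resolution (Suc i)"
proof (intro equalityI subsetI)
  fix Z :: "nat \<Rightarrow> ('v, 'k) mpoly vec set"
  assume Z: "Z \<in> lin_cycles resolution (Suc i)"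
  then obtain x where x: "\<And>p. x p \<in> fil (p - Suc i) (Suc i)" "\<And>p. Z p = gr_coset p (Suc i) (x p)"
    and fin: "finite {p. x p \<notin> fil (Suc p - Suc i) (Suc i)}"
    by (auto simp: lin_part_resolution)
  have dx: "twisted_diff pendant_prod (x p) \<in> fil (Suc p - i) i" for p
  proof -
    have "lin_diff resolution i Z p = filt resolution (Suc p) i" using Z by (simp add: fun_eq_iff)
    moreover have "lin_diff resolution i Z p = gr_coset p i (twisted_diff pendant_prod (x p))"
      by (rule lin_diff_gr_coset[where Z = Z and p = p, OF fil_chains[OF x(1)[of p]] x(2)[of p]])
    ultimately have "gr_coset p i (twisted_diff pendant_prod (x p)) = filt resolution (Suc p) i" by simp
    then show ?thesis
      by (rule iffD1[OF gr_coset_eq_filt_iff[OF twisted_diff_chains[OF fil_chains[OF x(1)[of p]]]]])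
  qed
  have lift: "\<exists>y. y \<in> fil (p - Suc (Suc i)) (Suc (Suc i)) \<and>
      (\<lambda>\<beta>. x p \<beta> - twisted_diff pendant_prod y \<beta>) \<in> fil (Suc p - Suc i) (Suc i) \<and>
      (x p \<in> fil (Suc p - Suc i) (Suc i) \<longrightarrow> y = (\<lambda>\<beta>. 0))" for p
  proof (cases "x p \<in> fil (Suc p - Suc i) (Suc i)")
    case True
    then show ?thesis by (intro exI[of _ "\<lambda>\<beta>. 0"]) simp
  next
    case False
    \<comment> \<open>For \<open>p \<le> i\<close> both filtration steps are all of \<open>F\<^bsub>i+1\<^esub>\<close> and the graded piece vanishes.\<close>
    have p: "Suc i \<le> p"
    proof (rule ccontr)
      assume "\<not> Suc i \<le> p"
      with False fil_chains[OF x(1)[of p]] show False by (simp add: fil_0)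
    qed
    from p have "Suc p - i = p - Suc i + 2" by simp
    from linear_part_exact[OF x(1) dx[of p, unfolded this]] p False show ?thesis
      by (auto simp: Suc_diff_Suc Suc_diff_le)
  qed
  from choice[OF allI[OF lift]] obtain y where y':
    "\<forall>p. y p \<in> fil (p - Suc (Suc i)) (Suc (Suc i)) \<and>
      (\<lambda>\<beta>. x p \<beta> - twisted_diff pendant_prod (y p) \<beta>) \<in> fil (Suc p - Suc i) (Suc i) \<and>
      (x p \<in> fil (Suc p - Suc i) (Suc i) \<longrightarrow> y p = (\<lambda>\<beta>. 0))" ..
  then have y: "\<And>p. y p \<in> fil (p - Suc (Suc i)) (Suc (Suc i))"
      "\<And>p. (\<lambda>\<beta>. x p \<beta> - twisted_diff pendant_prod (y p) \<beta>) \<in> fil (Suc p - Suc i) (Suc i)"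
      "\<And>p. x p \<in> fil (Suc p - Suc i) (Suc i) \<Longrightarrow> y p = (\<lambda>\<beta>. 0)"
    by simp_all
  define Y where "Y p = gr_coset p (Suc (Suc i)) (y p)" for p
  have "finite {p. y p \<notin> fil (Suc p - Suc (Suc i)) (Suc (Suc i))}"
    by (rule finite_subset[OF _ fin]) (use y(3) in auto)
  then have "Y \<in> lin_part resolution (Suc (Suc i))"
    unfolding lin_part_resolution Y_def using y(1) by (intro exI[of _ y]) simp
  moreover have "lin_diff resolution (Suc i) Y = Z"
  proof
    fix p
    have "lin_diff resolution (Suc i) Y p = gr_coset p (Suc i) (twisted_diff pendant_prod (y p))"
      by (rule lin_diff_gr_coset[OF fil_chains[OF y(1)] Y_def])
    also have "\<dots> = gr_coset p (Suc i) (x p)"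
      by (rule sym, rule iffD2[OF gr_coset_eq_iff[OF fil_chains[OF x(1)] twisted_diff_chains[OF fil_chains[OF y(1)]]] y(2)])
    finally show "lin_diff resolution (Suc i) Y p = Z p" by (simp add: x(2))
  qed
  ultimately show "Z \<in> lin_boundaries resolution (Suc i)" unfolding lin_boundaries_def by blast
next
  fix Z :: "nat \<Rightarrow> ('v, 'k) mpoly vec set"
  assume "Z \<in> lin_boundaries resolution (Suc i)"
  then obtain Y where Y: "Y \<in> lin_part resolution (Suc (Suc i))" "Z = lin_diff resolution (Suc i) Y"
    by (auto simp: lin_boundaries_def)
  then obtain y where y: "\<And>p. y p \<in> fil (p - Suc (Suc i)) (Suc (Suc i))" "\<And>p. Y p = gr_coset p (Suc (Suc i)) (y p)"
    and fin: "finite {p. y p \<notin> fil (Suc p - Suc (Suc i)) (Suc (Suc i))}"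
    by (auto simp: lin_part_resolution)
  define x where "x p = twisted_diff pendant_prod (y p)" for p
  have x: "x p \<in> fil (p - Suc i) (Suc i)" for p
    unfolding x_def by (rule twisted_diff_fil_step[OF y(1)])
  have Zp: "Z p = gr_coset p (Suc i) (x p)" for p
    unfolding Y(2) x_def by (rule lin_diff_gr_coset[OF fil_chains[OF y(1)] y(2)])
  have "finite {p. x p \<notin> fil (Suc p - Suc i) (Suc i)}"
  proof (rule finite_subset[OF _ fin], clarify)
    fix p
    assume "x p \<notin> fil (Suc p - Suc i) (Suc i)" "y p \<in> fil (Suc p - Suc (Suc i)) (Suc (Suc i))"
    with twisted_diff_fil_step[of "y p" "Suc p" "Suc i"] show False by (simp add: x_def)
  qed
  then have "Z \<in> lin_part resolution (Suc i)"
    unfolding lin_part_resolution using x Zp by (intro exI[of _ x]) simp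
  moreover have "lin_diff resolution i Z = (\<lambda>p. filt resolution (Suc p) i)"
  proof
    fix p
    have "lin_diff resolution i Z p = gr_coset p i (twisted_diff pendant_prod (x p))"
      by (rule lin_diff_gr_coset[OF fil_chains[OF x] Zp])
    then show "lin_diff resolution i Z p = filt resolution (Suc p) i"
      by (simp add: x_def twisted_diff_twisted_diff gr_coset_0)
  qed
  ultimately show "Z \<in> lin_cycles resolution (Suc i)" by simp
qed

lemma linearity_defect_resolution: "linearity_defect (resolution :: ('v, 'k::field) mpoly free_complex) = 0"
proof -
  have "i = 0" if "lin_cycles (resolution :: ('v, 'k) mpoly free_complex) i \<noteq> lin_boundaries resolution i" for i
    using that lin_cycles_eq_boundaries by (cases i) auto
  then have "Sup {enat i | i. lin_cycles (resolution :: ('v, 'k) mpoly free_complex) i \<noteq> lin_boundaries resolution i} \<le> 0"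
    by (intro Sup_least) (auto simp: zero_enat_def)
  then show ?thesis unfolding linearity_defect_def by simp
qed

lemma koszul_deficit_ideal:
  "koszul (mono_ideal {m. \<exists>b\<in>D. \<exists>r. m = gen_exp b + r} :: ('v, 'k::field) mpoly set)"
  unfolding koszul_def
  using graded_free_resolution_resolution minimal_complex_resolution linearity_defect_resolution by blast

end

section \<open>Symbolic powers of cover ideals\<close>

lemma cover_ideal_eq:
  fixes E :: "'v::finite set set"
  assumes "\<And>e. e \<in> E \<Longrightarrow> card e = 2"
  shows "cover_ideal E = (mono_ideal {m. \<forall>e\<in>E. 1 \<le> wt e m} :: ('v, 'k::field) mpoly set)"
proof -
  have "{ideal_span {var u, var v} | u v. {u, v} \<in> E} = ((\<lambda>e. wt_ideal e 1) ` E :: ('v, 'k) mpoly set set)"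
  proof (intro equalityI subsetI)
    fix P :: "('v, 'k) mpoly set" assume "P \<in> {ideal_span {var u, var v} | u v. {u, v} \<in> E}"
    then obtain u v where "P = ideal_span (var ` {u, v})" "{u, v} \<in> E" by auto
    then show "P \<in> (\<lambda>e. wt_ideal e 1) ` E" unfolding ideal_span_vars[OF finite] by blast
  next
    fix P :: "('v, 'k) mpoly set" assume "P \<in> (\<lambda>e. wt_ideal e 1) ` E"
    then obtain e where e: "e \<in> E" "P = ideal_span (var ` e)" by (auto simp: ideal_span_vars)
    obtain u v where "e = {u, v}" using assms[OF e(1)] by (auto simp: card_2_iff)
    with e show "P \<in> {ideal_span {var u, var v} | u v. {u, v} \<in> E}" by auto
  qed
  then have "cover_ideal E = (\<Inter>e\<in>E. wt_ideal e 1 :: ('v, 'k) mpoly set)"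
    unfolding cover_ideal_def by simp
  then show ?thesis by (auto simp: mono_ideal_def)
qed

theorem theorem1p5:
  fixes VH :: "'v::finite set" and EH EG :: "'v set set"
  assumes "simple_graph VH EH"
    and "VH \<noteq> {}"
    and "adds_pendants VH EH UNIV EG"
  shows "\<forall>n\<ge>1. koszul (symbolic_power (cover_ideal EG :: ('v, 'k::field) mpoly set) n)"
proof (intro allI impI)
  fix n :: nat
  obtain W f where W: "W \<inter> VH = {}" "f ` W = VH" "UNIV = VH \<union> W" and EG: "EG = EH \<union> {{f w, w} | w. w \<in> W}"
    using assms(3) by (auto simp: adds_pendants_def)
  have W_eq: "W = - VH" using W by auto
  have fw: "f w \<in> VH" "f w \<noteq> w" if "w \<in> W" for w
    using that W(1) imageI[OF that, of f] unfolding W(2) by auto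
  have EH: "e \<subseteq> VH" "card e = 2" if "e \<in> EH" for e using assms(1) that by (auto simp: simple_graph_def)
  have card2: "card e = 2" if "e \<in> EG" for e
    using that EH(2) fw(2) by (auto simp: EG)
  have cover: "cover_ideal EG = (mono_ideal {m. \<forall>e\<in>EG. 1 \<le> wt e m} :: ('v, 'k) mpoly set)"
    by (rule cover_ideal_eq) (rule card2)
  have symb: "symbolic_power (cover_ideal EG) n = (mono_ideal {m. \<forall>e\<in>EG. n \<le> wt e m} :: ('v, 'k) mpoly set)"
    unfolding cover
  proof (rule symbolic_power_inter_primes)
    show "e \<noteq> {}" if "e \<in> EG" for e using card2[OF that] by auto
    show "e' = e" if "e \<in> EG" "e' \<in> EG" "e' \<subseteq> e" for e e'
      using card_subset_eq[OF finite that(3)] card2 that by simp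
  qed
  define D where "D = {b. (\<forall>v. b v \<le> n) \<and> (\<forall>v. v \<notin> VH \<longrightarrow> b v = 0) \<and> (\<forall>e\<in>EH. sum b e \<le> n)}"
  interpret pendant_deficits D VH f n
  proof
    have "finite (PiE UNIV (\<lambda>_ :: 'v. {..n}))" by (intro finite_PiE) auto
    then show "finite D" by (rule finite_subset[rotated]) (auto simp: D_def)
    show "b' \<in> D" if b: "b \<in> D" and le: "\<And>v. b' v \<le> b v" for b b'
    proof -
      have "sum b' e \<le> n" if "e \<in> EH" for e
        using that b sum_mono[of e b' b] le by (force simp: D_def intro: order_trans)
      moreover have "b' v \<le> n" for v using b le[of v] by (auto simp: D_def intro: order_trans)
      moreover have "b' v = 0" if "v \<notin> VH" for v using b le[of v] that by (simp add: D_def)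
      ultimately show ?thesis by (simp add: D_def)
    qed
    show "f ` (- VH) = VH" using W W_eq by simp
  qed (auto simp: D_def)
  have "(\<forall>e\<in>EG. n \<le> wt e m) \<longleftrightarrow> (\<exists>b\<in>D. \<exists>r. m = gen_exp b + r)" for m
  proof
    assume m: "\<forall>e\<in>EG. n \<le> wt e m"
    \<comment> \<open>The deficit at \<open>v\<close> is 0, by truncation, if the exponent of \<open>x\<^sub>v\<close> exceeds \<open>n\<close>.\<close>
    define b where "b v = (if v \<in> VH then n - Poly_Mapping.lookup m v else 0)" for v
    have "sum b e \<le> n" if e: "e \<in> EH" for e
    proof -
      obtain u v where uv: "e = {u, v}" "u \<noteq> v" using EH(2)[OF e] by (auto simp: card_2_iff)
      then have "n \<le> Poly_Mapping.lookup m u + Poly_Mapping.lookup m v"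
        using m e by (force simp: EG wt_def)
      then show ?thesis using uv EH(1)[OF e] by (simp add: b_def)
    qed
    then have "b \<in> D" by (simp add: D_def b_def)
    moreover have "\<exists>r. m = gen_exp b + r"
    proof (rule mon_divides_lookup)
      fix v
      show "Poly_Mapping.lookup (gen_exp b) v \<le> Poly_Mapping.lookup m v"
      proof (cases "v \<in> VH")
        case True
        then show ?thesis by (simp add: lookup_gen_exp b_def)
      next
        case False
        then have v: "v \<in> W" using W_eq by simp
        with m have "n \<le> wt {f v, v} m" by (auto simp: EG)
        with fw[OF v] False show ?thesis by (simp add: lookup_gen_exp b_def wt_def)
      qed
    qed
    ultimately show "\<exists>b\<in>D. \<exists>r. m = gen_exp b + r" by blast
  next
    assume "\<exists>b\<in>D. \<exists>r. m = gen_exp b + r"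
    then obtain b r where b: "b \<in> D" "m = gen_exp b + r" by blast
    have "n \<le> wt e (gen_exp b)" if e: "e \<in> EG" for e
    proof (cases "e \<in> EH")
      case True
      obtain u v where uv: "e = {u, v}" "u \<noteq> v" using EH(2)[OF True] by (auto simp: card_2_iff)
      have "b u + b v \<le> n" using b(1) True uv by (force simp: D_def)
      then show ?thesis using uv EH(1)[OF True] by (simp add: wt_def lookup_gen_exp)
    next
      case False
      then obtain w where w: "e = {f w, w}" "w \<in> W" using e by (auto simp: EG)
      have "b (f w) \<le> n" using b(1) by (simp add: D_def)
      then show ?thesis using w fw[OF w(2)] W_eq by (auto simp: wt_def lookup_gen_exp)
    qed
    then show "\<forall>e\<in>EG. n \<le> wt e m" by (simp add: b(2) trans_le_add1)
  qed
  then have "symbolic_power (cover_ideal EG) n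
      = (mono_ideal {m. \<exists>b\<in>D. \<exists>r. m = gen_exp b + r} :: ('v, 'k) mpoly set)"
    unfolding symb by simp
  then show "koszul (symbolic_power (cover_ideal EG :: ('v, 'k) mpoly set) n)"
    using koszul_deficit_ideal by simp
qed

end
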